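(* Let $f=\frac1n\sum_{i=1}^n f_i$, where each $f_i:\mathbb{R}^d\to\mathbb{R}$ is differentiable, bounded below by $f_i^{\inf}\in\mathbb{R}$, and ${\bf L}_i$-matrix smooth with ${\bf L}_i\in\mathbb{S}^d_{++}$. Assume $f(x)\ge f^{\inf}$ for all $x$ (some $f^{\inf}\in\mathbb{R}$) and that $f$ is ${\bf L}$-matrix smooth with ${\bf L}\in\mathbb{S}^d_+$. Let $\{{\bf S}_i^k: i\in[n],k\ge0\}$ be mutually independent random matrices, each with a common distribution $\mathcal S$ on $\mathbb{S}^d_+$ satisfying $\mathbb{E}[{\bf S}_i^k]={\bf I}_d$. Let ${\bf D}\in\mathbb{S}^d_{++}$ satisfy ${\bf D}{\bf L}{\bf D}\preceq{\bf D}$, fix $x^0$, and let $$x^{k+1}=x^k-\frac{{\bf D}}{n}\sum_{i=1}^n{\bf S}_i^k\nabla f_i(x^k).$$ Then for every $K\ge1$, $$\min_{0\le k\le K-1}\mathbb{E}\Big[\|\nabla f(x^k)\|^2_{{\bf D}/\det({\bf D})^{1/d}}\Big]\le\frac{2(1+\frac{\lambda_{{\bf D}}}{n})^K(f(x^0)-f^{\inf})}{\det({\bf D})^{1/d}K}+\frac{2\lambda_{{\bf D}}\Delta^{\inf}}{\det({\bf D})^{1/d}n},$$ where $\Delta^{\inf}:=f^{\inf}-\frac1n\sum_{i=1}^nf_i^{\inf}$ and $\lambda_{{\bf D}}:=\max_i\lambda_{\max}\big(\mathbb{E}[{\bf L}_i^{1/2}({\bf S}_i^k-{\bf I}_d){\bf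 D}{\bf L}{\bf D}({\bf S}_i^k-{\bf I}_d){\bf L}_i^{1/2}]\big)$.
   Context: A differentiable $g:\mathbb{R}^d\to\mathbb{R}$ is ${\bf M}$-matrix smooth if $g(x)\le g(y)+\langle\nabla g(y),x-y\rangle+\frac12\langle{\bf M}(x-y),x-y\rangle$ for all $x,y$. $\mathbb{S}^d_{+}$/$\mathbb{S}^d_{++}$: symmetric positive semidefinite/definite $d\times d$ matrices; $\preceq$ is the Loewner order; $\|x\|_{{\bf Q}}^2:=\langle{\bf Q}x,x\rangle$. All expectations are assumed finite. *)

theory Defs
  imports "HOL-Probability.Probability"
begin

definition psd :: "real^'d^'d \<Rightarrow> bool" where
  "psd A \<longleftrightarrow> transpose A = A \<and> (\<forall>x. 0 \<le> x \<bullet> (A *v x))"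

definition pd :: "real^'d^'d \<Rightarrow> bool" where
  "pd A \<longleftrightarrow> transpose A = A \<and> (\<forall>x. x \<noteq> 0 \<longrightarrow> 0 < x \<bullet> (A *v x))"

definition loewner_le :: "real^'d^'d \<Rightarrow> real^'d^'d \<Rightarrow> bool" where
  "loewner_le A B \<longleftrightarrow> psd (B - A)"

definition qnorm2 :: "real^'d^'d \<Rightarrow> real^'d \<Rightarrow> real" where
  "qnorm2 Q x = x \<bullet> (Q *v x)"

definition grad :: "(real^'d \<Rightarrow> real) \<Rightarrow> real^'d \<Rightarrow> real^'d" where
  "grad g x = (THE v. (g has_derivative (\<lambda>h. v \<bullet> h)) (at x))"

definition matrix_smooth :: "real^'d^'d \<Rightarrow> (real^'d \<Rightarrow> real) \<Rightarrow> bool" where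
  "matrix_smooth M g \<longleftrightarrow> (\<forall>x. g differentiable (at x)) \<and>
     (\<forall>x y. g x \<le> g y + grad g y \<bullet> (x - y) + (1/2) * ((M *v (x - y)) \<bullet> (x - y)))"

definition msqrt :: "real^'d^'d \<Rightarrow> real^'d^'d" where
  "msqrt A = (THE R. psd R \<and> R ** R = A)"

definition lambda_max :: "real^'d^'d \<Rightarrow> real" where
  "lambda_max A = Max {c. \<exists>v. v \<noteq> 0 \<and> A *v v = c *\<^sub>R v}"

end

theory Submission
  imports Defs
begin

text \<open>
  Write \<open>Q = D L D\<close> and \<open>g\<^sub>k = \<nabla>f(x\<^sup>k)\<close>. The step is \<open>x\<^sup>k\<^sup>+\<^sup>1 = x\<^sup>k - D (g\<^sub>k + \<xi>\<^sub>k / n)\<close> with noise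
  \<open>\<xi>\<^sub>k = \<Sum>\<^sub>i (S\<^sub>i\<^sup>k - I) \<nabla>f\<^sub>i(x\<^sup>k)\<close>, so smoothness of \<open>f\<close> and \<open>Q \<preceq> D\<close> give
  \<open>f(x\<^sup>k\<^sup>+\<^sup>1) \<le> f(x\<^sup>k) - \<parallel>g\<^sub>k\<parallel>\<^sup>2/2\<close> (in the \<open>D\<close>-norm) plus a term linear in \<open>\<xi>\<^sub>k\<close>, whose mean is zero, plus
  \<open>\<parallel>\<xi>\<^sub>k\<parallel>\<^sup>2 / 2n\<^sup>2\<close> in the \<open>Q\<close>-norm. Independence kills the off-diagonal part of \<open>E \<parallel>\<xi>\<^sub>k\<parallel>\<^sup>2\<close>, and with
  \<open>\<nabla>f\<^sub>i = L\<^sub>i\<^sup>1\<^sup>/\<^sup>2 w\<^sub>i\<close> the diagonal part is at most \<open>\<lambda>\<^sub>D \<Sum>\<^sub>i E \<parallel>w\<^sub>i\<parallel>\<^sup>2\<close>, where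
  \<open>\<parallel>w\<^sub>i\<parallel>\<^sup>2 \<le> 2 (f\<^sub>i - f\<^sub>i\<^sup>i\<^sup>n\<^sup>f)\<close> by smoothness of \<open>f\<^sub>i\<close>. With \<open>\<delta>\<^sub>k = E f(x\<^sup>k) - f\<^sup>i\<^sup>n\<^sup>f\<close> this yields
  \<open>\<delta>\<^sub>k\<^sub>+\<^sub>1 \<le> (1 + \<lambda>\<^sub>D/n) \<delta>\<^sub>k - E \<parallel>g\<^sub>k\<parallel>\<^sup>2/2 + \<lambda>\<^sub>D \<Delta>\<^sup>i\<^sup>n\<^sup>f/n\<close>, which is summed with geometric weights.
\<close>

section \<open>Spectral theorem and matrix square roots\<close>

lemma symmetric_inner_matrix_vector:
  fixes A :: "real^'d^'d"
  assumes "transpose A = A"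
  shows "x \<bullet> (A *v y) = (A *v x) \<bullet> y"
  by (metis assms dot_lmul_matrix transpose_matrix_vector)

text \<open>A maximizer \<open>u\<close> of the Rayleigh quotient exists because the unit sphere of
  \<open>V\<close> is compact. Perturbing \<open>u\<close> along the residual \<open>w\<close>,
  which stays in \<open>V\<close> by invariance, shows that the residual vanishes.\<close>

lemma symmetric_invariant_subspace_eigenvector:
  fixes A :: "real^'d^'d"
  assumes sym: "transpose A = A"
    and V: "subspace V" "V \<noteq> {0}" "\<And>v. v \<in> V \<Longrightarrow> A *v v \<in> V"
  obtains u c where "u \<in> V" "norm u = 1" "A *v u = c *\<^sub>R u"
proof -
  let ?K = "V \<inter> sphere 0 1"
  obtain v where v: "v \<in> V" "v \<noteq> 0"
    using V(1,2) subspace_0 by blast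
  have "compact ?K"
    using V(1) by (simp add: closed_Int_compact closed_subspace)
  moreover have "(1 / norm v) *\<^sub>R v \<in> ?K"
    using v V(1) by (auto simp: subspace_scale)
  moreover have "continuous_on ?K (\<lambda>v. v \<bullet> (A *v v))"
    by (intro continuous_intros)
  ultimately obtain u where u: "u \<in> ?K" and umax: "\<And>v. v \<in> ?K \<Longrightarrow> v \<bullet> (A *v v) \<le> u \<bullet> (A *v u)"
    using continuous_attains_sup[of ?K "\<lambda>v. v \<bullet> (A *v v)"] by blast
  define c where "c = u \<bullet> (A *v u)"
  have bound: "v \<bullet> (A *v v) \<le> c * (v \<bullet> v)" if "v \<in> V" for v
  proof (cases "v = 0")
    case False
    have "(1 / norm v) *\<^sub>R v \<in> ?K"
      using that False V(1) by (auto simp: subspace_scale)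
    from umax[OF this] have "(v \<bullet> (A *v v)) / (norm v)\<^sup>2 \<le> c"
      by (simp add: c_def matrix_vector_mult_scaleR power2_eq_square)
    then show ?thesis
      using False by (simp add: divide_le_eq power2_norm_eq_inner)
  qed simp
  define w where "w = A *v u - c *\<^sub>R u"
  have w: "w \<in> V"
    using u V by (simp add: w_def subspace_diff subspace_scale)
  have uu: "u \<bullet> u = 1"
    using u by (simp add: dot_square_norm)
  define C where "C = c * (w \<bullet> w) - w \<bullet> (A *v w)"
  have C: "C \<ge> 0"
    using bound[OF w] by (simp add: C_def)
  \<comment> \<open>Inserting \<open>u + t w\<close> into \<open>bound\<close> and using
    \<open>A u = w + c u\<close>, the terms in \<open>u\<close> cancel. What remains compares a
    first-order term in \<open>t\<close> with a second-order one.\<close>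
  have pert: "2 * t * (w \<bullet> w) \<le> t\<^sup>2 * C" for t
  proof -
    have "u + t *\<^sub>R w \<in> V"
      using u w V(1) by (simp add: subspace_add subspace_scale)
    note b = bound[OF this]
    have uw: "u \<bullet> (A *v w) = (A *v u) \<bullet> w"
      by (rule symmetric_inner_matrix_vector[OF sym])
    have e1: "(u + t *\<^sub>R w) \<bullet> (A *v (u + t *\<^sub>R w))
        = c + 2 * t * ((A *v u) \<bullet> w) + t\<^sup>2 * (w \<bullet> (A *v w))"
      using uw by (simp add: c_def algebra_simps inner_simps matrix_vector_right_distrib
          matrix_vector_mult_scaleR power2_eq_square inner_commute)
    have e2: "(u + t *\<^sub>R w) \<bullet> (u + t *\<^sub>R w) = 1 + 2 * t * (u \<bullet> w) + t\<^sup>2 * (w \<bullet> w)"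
      using uu by (simp add: algebra_simps inner_simps power2_eq_square inner_commute)
    have e3: "(A *v u) \<bullet> w = w \<bullet> w + c * (u \<bullet> w)"
      unfolding inner_add_left[symmetric] inner_scaleR_left[symmetric] by (simp add: w_def)
    show ?thesis
      using b unfolding e1 e2 e3 C_def by (simp add: algebra_simps)
  qed
  have "w \<bullet> w = 0"
  proof (rule ccontr)
    assume "w \<bullet> w \<noteq> 0"
    then have p: "w \<bullet> w > 0" by (simp add: order.not_eq_order_implies_strict)
    \<comment> \<open>Small enough that \<open>t * C\<close> is at most
      \<open>w \<bullet> w\<close>, while \<open>pert\<close> demands twice that; the
      \<open>+ 1\<close> keeps the denominator positive when \<open>C = 0\<close>.\<close>
    define t where "t = (w \<bullet> w) / (C + 1)"
    have t: "t > 0" using p C by (simp add: t_def)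
    have "2 * (w \<bullet> w) \<le> t * C"
      using pert[of t] t by (simp add: power2_eq_square mult.assoc)
    also have "t * C \<le> w \<bullet> w"
      using p C by (simp add: t_def field_simps)
    finally show False using p by simp
  qed
  then have "A *v u = c *\<^sub>R u"
    by (simp add: w_def)
  then show thesis
    using that u by auto
qed

text \<open>Eigenvalues are attached to the basis vectors themselves, so repeated eigenvalues call
  for no enumeration of \<open>B\<close>.\<close>

definition orthonormal_eigenbasis :: "real^'d^'d \<Rightarrow> (real^'d) set \<Rightarrow> (real^'d \<Rightarrow> real) \<Rightarrow> bool" where
  "orthonormal_eigenbasis A B \<mu> \<longleftrightarrow> finite B \<and> pairwise orthogonal B \<and> (\<forall>b\<in>B. norm b = 1) \<and>
     span B = UNIV \<and> (\<forall>b\<in>B. A *v b = \<mu> b *\<^sub>R b)"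

text \<open>Take an orthonormal set of eigenvectors of largest cardinality, which exists since the
  dimension bounds all cardinalities. If it did not span, its orthogonal complement would be a
  nonzero subspace, invariant by symmetry, and would supply one more eigenvector.\<close>

theorem symmetric_orthonormal_eigenbasis:
  fixes A :: "real^'d^'d"
  assumes sym: "transpose A = A"
  obtains B \<mu> where "orthonormal_eigenbasis A B \<mu>"
proof -
  define good where "good B \<longleftrightarrow> pairwise orthogonal B \<and> (\<forall>b\<in>B. norm b = 1 \<and> (\<exists>c. A *v b = c *\<^sub>R b))"
    for B :: "(real^'d) set"
  have indep: "independent B" if "good B" for B
    using that by (intro pairwise_orthogonal_independent) (auto simp: good_def)
  have "card B \<le> DIM(real^'d)" if "good B" for B
    using independent_bound[OF indep[OF that]] by simp
  moreover have "good {}"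
    by (simp add: good_def)
  ultimately obtain B where B: "good B" and Bmax: "\<And>B'. good B' \<Longrightarrow> card B' \<le> card B"
    using ex_has_greatest_nat[of good "{}" card "Suc DIM(real^'d)"] by (metis less_Suc_eq_le)
  have finB: "finite B"
    using indep[OF B] independent_bound by blast
  have "span B = UNIV"
  proof (rule ccontr)
    assume ne: "span B \<noteq> UNIV"
    define V where "V = {v. \<forall>b\<in>B. orthogonal b v}"
    have subV: "subspace V"
      unfolding V_def by (rule subspace_orthogonal_to_vectors)
    obtain a where a: "a \<noteq> 0" "\<And>x. x \<in> span B \<Longrightarrow> orthogonal a x"
      using ne span_not_UNIV_orthogonal[of B] by (auto simp: orthogonal_def)
    then have "a \<in> V"
      by (auto simp: V_def orthogonal_commute span_base)
    then have "V \<noteq> {0}" using a by blast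
    moreover have "A *v v \<in> V" if "v \<in> V" for v
      unfolding V_def orthogonal_def
    proof (safe)
      fix b assume b: "b \<in> B"
      then obtain c where "A *v b = c *\<^sub>R b" using B by (auto simp: good_def)
      then show "b \<bullet> (A *v v) = 0"
        using that b symmetric_inner_matrix_vector[OF sym, of b v] by (simp add: V_def orthogonal_def)
    qed
    ultimately obtain u c where u: "u \<in> V" "norm u = 1" "A *v u = c *\<^sub>R u"
      using symmetric_invariant_subspace_eigenvector[OF sym subV] by metis
    have "u \<notin> B"
      using u by (auto simp: V_def orthogonal_def)
    moreover have "good (insert u B)"
      using B u by (auto simp: good_def V_def pairwise_insert orthogonal_commute)
    ultimately show False
      using Bmax[of "insert u B"] finB by simp
  qed
  moreover obtain \<mu> where "\<forall>b\<in>B. A *v b = \<mu> b *\<^sub>R b"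
    using B unfolding good_def by metis
  ultimately show thesis
    using that[of B \<mu>] B finB by (auto simp: orthonormal_eigenbasis_def good_def)
qed

lemma orthonormal_eigenbasis_expand:
  assumes "orthonormal_eigenbasis A B \<mu>"
  shows "x = (\<Sum>b\<in>B. (x \<bullet> b) *\<^sub>R b)"
  using assms orthonormal_basis_expand[of B x] by (auto simp: orthonormal_eigenbasis_def)

lemma orthonormal_eigenbasis_inner:
  assumes "orthonormal_eigenbasis A B \<mu>" "b \<in> B" "b' \<in> B"
  shows "b \<bullet> b' = (if b = b' then 1 else 0)"
  using assms by (auto simp: orthonormal_eigenbasis_def pairwise_def orthogonal_def dot_square_norm)

lemma orthonormal_eigenbasis_norm:
  assumes "orthonormal_eigenbasis A B \<mu>"
  shows "x \<bullet> x = (\<Sum>b\<in>B. (x \<bullet> b)\<^sup>2)"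
proof -
  have "x \<bullet> x = x \<bullet> (\<Sum>b\<in>B. (x \<bullet> b) *\<^sub>R b)"
    using orthonormal_eigenbasis_expand[OF assms, of x] by simp
  then show ?thesis
    by (simp add: inner_sum_right power2_eq_square)
qed

lemma orthonormal_eigenbasis_apply:
  assumes "orthonormal_eigenbasis A B \<mu>"
  shows "A *v x = (\<Sum>b\<in>B. (\<mu> b * (x \<bullet> b)) *\<^sub>R b)"
proof -
  have "A *v x = A *v (\<Sum>b\<in>B. (x \<bullet> b) *\<^sub>R b)"
    using orthonormal_eigenbasis_expand[OF assms, of x] by simp
  also have "\<dots> = (\<Sum>b\<in>B. (x \<bullet> b) *\<^sub>R (A *v b))"
    by (simp add: linear_sum[OF matrix_vector_mul_linear] matrix_vector_mult_scaleR)
  also have "\<dots> = (\<Sum>b\<in>B. (\<mu> b * (x \<bullet> b)) *\<^sub>R b)"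
    using assms by (intro sum.cong) (auto simp: orthonormal_eigenbasis_def)
  finally show ?thesis .
qed

lemma orthonormal_eigenbasis_quadratic_form:
  assumes "orthonormal_eigenbasis A B \<mu>"
  shows "x \<bullet> (A *v x) = (\<Sum>b\<in>B. \<mu> b * (x \<bullet> b)\<^sup>2)"
  by (simp add: orthonormal_eigenbasis_apply[OF assms] inner_sum_right power2_eq_square mult.assoc)

text \<open>An eigenvector has a nonzero coefficient along some \<open>b\<close>, and pairing the
  eigenvalue equation with that \<open>b\<close> forces \<open>c = \<mu> b\<close>. This exhibits
  the set inside \<open>lambda_max\<close> as finite, so that \<open>Max\<close> bounds its
  elements.\<close>

lemma orthonormal_eigenbasis_eigenvalues:
  fixes A :: "real^'d^'d"
  assumes sym: "transpose A = A" and B: "orthonormal_eigenbasis A B \<mu>"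
  shows "{c. \<exists>v. v \<noteq> 0 \<and> A *v v = c *\<^sub>R v} = \<mu> ` B"
proof (intro equalityI subsetI)
  fix c assume "c \<in> {c. \<exists>v. v \<noteq> 0 \<and> A *v v = c *\<^sub>R v}"
  then obtain v where v: "v \<noteq> 0" "A *v v = c *\<^sub>R v" by blast
  obtain b where b: "b \<in> B" "v \<bullet> b \<noteq> 0"
    using v(1) orthonormal_eigenbasis_norm[OF B, of v]
    by (metis (mono_tags, lifting) inner_eq_zero_iff sum.neutral zero_power2)
  have "A *v b = \<mu> b *\<^sub>R b"
    using B b by (auto simp: orthonormal_eigenbasis_def)
  then have "\<mu> b * (v \<bullet> b) = c * (v \<bullet> b)"
    using symmetric_inner_matrix_vector[OF sym, of v b] v by simp
  then show "c \<in> \<mu> ` B" using b by auto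
next
  fix c assume "c \<in> \<mu> ` B"
  then obtain b where "b \<in> B" "c = \<mu> b" by blast
  moreover from this have "b \<noteq> 0" "A *v b = \<mu> b *\<^sub>R b"
    using B by (auto simp: orthonormal_eigenbasis_def)
  ultimately show "c \<in> {c. \<exists>v. v \<noteq> 0 \<and> A *v v = c *\<^sub>R v}" by blast
qed

text \<open>In an eigenbasis both sides are sums of the same squares with different weights. This
  links the definition of \<open>lambda_max\<close> by eigenvalues to the variational bound that the
  convergence proof uses.\<close>

lemma quadratic_form_le_lambda_max:
  fixes A :: "real^'d^'d"
  assumes sym: "transpose A = A"
  shows "x \<bullet> (A *v x) \<le> lambda_max A * (x \<bullet> x)"
proof -
  obtain B \<mu> where B: "orthonormal_eigenbasis A B \<mu>"
    using symmetric_orthonormal_eigenbasis[OF sym] .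
  have "\<mu> b \<le> lambda_max A" if "b \<in> B" for b
    unfolding lambda_max_def orthonormal_eigenbasis_eigenvalues[OF sym B]
    using B that by (intro Max_ge) (auto simp: orthonormal_eigenbasis_def)
  then show ?thesis
    unfolding orthonormal_eigenbasis_quadratic_form[OF B] orthonormal_eigenbasis_norm[OF B] sum_distrib_left
    by (intro sum_mono mult_right_mono) auto
qed

lemma lambda_max_nonneg:
  fixes A :: "real^'d^'d"
  assumes "psd A"
  shows "0 \<le> lambda_max A"
proof -
  obtain i :: 'd where True by simp
  have "axis i 1 \<bullet> axis i (1::real) = 1"
    by (simp add: inner_axis_axis)
  moreover have "0 \<le> axis i 1 \<bullet> (A *v axis i 1)" "transpose A = A"
    using assms unfolding psd_def by blast+
  ultimately show ?thesis
    using quadratic_form_le_lambda_max[of A "axis i 1"] by simp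
qed

text \<open>The factorization \<open>(R + sqrt c) (R - sqrt c) v = 0\<close> makes
  \<open>w = (R - sqrt c) v\<close> satisfy \<open>R w = - sqrt c w\<close>, which a positive
  semidefinite \<open>R\<close> allows only for \<open>w = 0\<close>. Hence a root is determined on
  every eigenvector of its square with positive eigenvalue.\<close>

lemma psd_sqrt_eigenvector:
  fixes R :: "real^'d^'d"
  assumes R: "psd R" and v: "(R ** R) *v v = c *\<^sub>R v" and c: "c > 0"
  shows "R *v v = sqrt c *\<^sub>R v"
proof -
  define w where "w = R *v v - sqrt c *\<^sub>R v"
  have "R *v w = - sqrt c *\<^sub>R w"
  proof -
    have "R *v w = (R ** R) *v v - sqrt c *\<^sub>R (R *v v)"
      by (simp add: w_def matrix_vector_mult_diff_distrib matrix_vector_mult_scaleR matrix_vector_mul_assoc)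
    also have "\<dots> = - sqrt c *\<^sub>R w"
      using v c by (simp add: w_def scaleR_diff_right)
    finally show ?thesis .
  qed
  moreover have "0 \<le> w \<bullet> (R *v w)"
    using R by (simp add: psd_def)
  ultimately have "sqrt c * (w \<bullet> w) \<le> 0"
    by simp
  then have "w \<bullet> w \<le> 0"
    using c by (simp add: mult_le_0_iff)
  then have "w = 0"
    by (metis inner_gt_zero_iff not_less)
  then show ?thesis
    by (simp add: w_def)
qed

text \<open>Justifies the definite description in \<open>msqrt\<close>. Existence takes square roots
  of the eigenvalues in an eigenbasis; uniqueness holds because any other root acts in the same way
  on that basis.\<close>

lemma pd_unique_psd_sqrt:
  fixes A :: "real^'d^'d"
  assumes "pd A"
  shows "\<exists>!R. psd R \<and> R ** R = A"
proof -
  have sym: "transpose A = A"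
    using assms by (simp add: pd_def)
  obtain B \<mu> where B: "orthonormal_eigenbasis A B \<mu>"
    using symmetric_orthonormal_eigenbasis[OF sym] .
  have finB: "finite B" and eig: "\<And>b. b \<in> B \<Longrightarrow> A *v b = \<mu> b *\<^sub>R b" and nB: "\<And>b. b \<in> B \<Longrightarrow> norm b = 1"
    using B by (auto simp: orthonormal_eigenbasis_def)
  have \<mu>: "\<mu> b > 0" if "b \<in> B" for b
  proof -
    have "b \<noteq> 0" using nB[OF that] by auto
    then have "0 < b \<bullet> (A *v b)" using assms by (simp add: pd_def)
    then show ?thesis using eig[OF that] nB[OF that] by (simp add: dot_square_norm)
  qed
  define h where "h x = (\<Sum>b\<in>B. (sqrt (\<mu> b) * (x \<bullet> b)) *\<^sub>R b)" for x :: "real^'d"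
  have "linear h"
    unfolding h_def
    by (intro linearI) (simp_all add: inner_simps algebra_simps scaleR_sum_right sum.distrib)
  define R where "R = matrix h"
  have Rv: "R *v x = h x" for x
    using \<open>linear h\<close> by (simp add: R_def matrix_works)
  have R_sym: "transpose R = R"
  proof -
    have "x \<bullet> (R *v y) = (transpose R *v x) \<bullet> y" for x y
      by (simp add: dot_lmul_matrix)
    moreover have "x \<bullet> (R *v y) = (R *v x) \<bullet> y" for x y
      by (simp add: Rv h_def inner_sum_left inner_sum_right mult.commute mult.left_commute inner_commute)
    ultimately have "transpose R *v x = R *v x" for x
      by (metis vector_eq_rdot)
    then show ?thesis
      by (simp add: matrix_eq)
  qed
  have "0 \<le> x \<bullet> (R *v x)" for x
    using \<mu> by (auto simp: Rv h_def inner_sum_right mult.assoc less_imp_le intro!: sum_nonneg)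
  then have R_psd: "psd R"
    using R_sym by (simp add: psd_def)
  have eqI: "P = Q" if "\<And>b. b \<in> B \<Longrightarrow> P *v b = Q *v b" for P Q :: "real^'d^'d"
  proof -
    have "P *v x = Q *v x" for x
    proof (rule linear_eq_on[of "(*v) P" "(*v) Q" x B])
      show "x \<in> span B" using B by (auto simp: orthonormal_eigenbasis_def)
    qed (auto simp: that)
    then show ?thesis by (simp add: matrix_eq)
  qed
  have Rb: "R *v b = sqrt (\<mu> b) *\<^sub>R b" if "b \<in> B" for b
  proof -
    have "R *v b = (\<Sum>b'\<in>B. if b' = b then sqrt (\<mu> b) *\<^sub>R b else 0)"
      unfolding Rv h_def using that
      by (intro sum.cong) (auto simp: orthonormal_eigenbasis_inner[OF B])
    then show ?thesis using finB that by simp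
  qed
  have "R ** R = A"
  proof (rule eqI)
    fix b assume b: "b \<in> B"
    then show "(R ** R) *v b = A *v b"
      using \<mu>[OF b] by (simp add: Rb eig matrix_vector_mult_scaleR flip: matrix_vector_mul_assoc)
  qed
  moreover have "R' = R" if "psd R'" "R' ** R' = A" for R'
  proof (rule eqI)
    fix b assume b: "b \<in> B"
    then show "R' *v b = R *v b"
      using psd_sqrt_eigenvector[OF that(1), of b "\<mu> b"] that(2) eig \<mu> Rb by simp
  qed
  ultimately show ?thesis
    using R_psd by blast
qed

lemma
  assumes "pd A"
  shows msqrt_psd: "psd (msqrt A)" and msqrt_square: "msqrt A ** msqrt A = A"
  using theI'[OF pd_unique_psd_sqrt[OF assms]] by (auto simp: msqrt_def)

lemma pd_invertible:
  fixes A :: "real^'d^'d"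
  assumes "pd A"
  shows "invertible A"
proof -
  have "x = 0" if "A *v x = 0" for x
    using assms that by (metis pd_def inner_zero_right less_irrefl)
  then show ?thesis
    by (simp add: invertible_left_inverse matrix_left_invertible_ker)
qed

lemma msqrt_invertible:
  fixes A :: "real^'d^'d"
  assumes "pd A"
  shows "invertible (msqrt A)"
  by (metis assms det_mul invertible_det_nz msqrt_square mult_zero_left pd_invertible)

lemma inner_transpose_mult_form:
  fixes B Q :: "real^'d^'d"
  shows "u \<bullet> ((transpose B ** Q ** B) *v v) = (B *v u) \<bullet> (Q *v (B *v v))"
proof -
  have "u \<bullet> (transpose B *v y) = (B *v u) \<bullet> y" for y
    by (metis dot_lmul_matrix inner_commute transpose_matrix_vector)
  then show ?thesis
    by (metis matrix_vector_mul_assoc)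
qed

lemma transpose_eqI:
  fixes A :: "real^'d^'d"
  assumes "\<And>u v. u \<bullet> (A *v v) = v \<bullet> (A *v u)"
  shows "transpose A = A"
proof -
  have "transpose A *v x = A *v x" for x
    using assms by (metis dot_lmul_matrix inner_commute transpose_matrix_vector vector_eq_rdot)
  then show ?thesis
    by (simp add: matrix_eq)
qed

lemma psd_congruence:
  fixes B Q :: "real^'d^'d"
  assumes "psd Q"
  shows "psd (transpose B ** Q ** B)"
  unfolding psd_def
proof (intro conjI allI)
  show "transpose (transpose B ** Q ** B) = transpose B ** Q ** B"
    using assms by (simp add: matrix_transpose_mul psd_def matrix_mul_assoc)
  show "0 \<le> x \<bullet> ((transpose B ** Q ** B) *v x)" for x
    using assms by (simp only: inner_transpose_mult_form psd_def)
qed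

section \<open>Gradients and matrix smoothness\<close>

lemma grad_eqI:
  assumes "(g has_derivative (\<lambda>h. v \<bullet> h)) (at y)"
  shows "grad g y = v"
  unfolding grad_def
proof (rule the_equality)
  show "(g has_derivative (\<lambda>h. v \<bullet> h)) (at y)" by fact
  fix v' assume "(g has_derivative (\<lambda>h. v' \<bullet> h)) (at y)"
  from has_derivative_unique[OF this assms] show "v' = v"
    by (metis vector_eq_rdot)
qed

text \<open>The derivative is represented by its adjoint applied to 1, and uniqueness of the
  representing vector identifies it with the description in \<open>grad\<close>.\<close>

lemma has_derivative_grad:
  fixes g :: "real^'d \<Rightarrow> real"
  assumes "g differentiable (at y)"
  shows "(g has_derivative (\<lambda>h. grad g y \<bullet> h)) (at y)"
proof -
  obtain g' where g': "(g has_derivative g') (at y)"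
    using assms by (auto simp: differentiable_def)
  then have "linear g'"
    by (rule has_derivative_linear)
  then have "g' h = adjoint g' 1 \<bullet> h" for h
    using adjoint_works[of g' h 1] by (simp add: inner_commute)
  then have "g' = (\<lambda>h. adjoint g' 1 \<bullet> h)" by blast
  then have "(g has_derivative (\<lambda>h. adjoint g' 1 \<bullet> h)) (at y)"
    using g' by simp
  then show ?thesis
    using grad_eqI by metis
qed

lemma grad_average:
  fixes f :: "'i \<Rightarrow> real^'d \<Rightarrow> real"
  assumes "\<And>i. i \<in> I \<Longrightarrow> f i differentiable (at y)"
  shows "grad (\<lambda>y. c * (\<Sum>i\<in>I. f i y)) y = c *\<^sub>R (\<Sum>i\<in>I. grad (f i) y)"
proof (rule grad_eqI)
  have "((\<lambda>y. c * (\<Sum>i\<in>I. f i y)) has_derivative (\<lambda>h. c * (\<Sum>i\<in>I. grad (f i) y \<bullet> h))) (at y)"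
    by (intro has_derivative_mult_right has_derivative_sum has_derivative_grad assms)
  then show "((\<lambda>y. c * (\<Sum>i\<in>I. f i y)) has_derivative (\<lambda>h. c *\<^sub>R (\<Sum>i\<in>I. grad (f i) y) \<bullet> h)) (at y)"
    by (simp add: inner_sum_left)
qed

text \<open>The gradient may be discontinuous, but each directional derivative is the pointwise
  limit of difference quotients of the continuous function \<open>g\<close> with step lengths
  1/(m+1).\<close>

lemma borel_measurable_grad:
  fixes g :: "real^'d \<Rightarrow> real"
  assumes g: "\<And>y. g differentiable (at y)"
  shows "grad g \<in> borel_measurable borel"
proof -
  have cont: "continuous_on UNIV g"
    using g by (meson continuous_at_imp_continuous_on differentiable_imp_continuous_within)
  then have [measurable]: "g \<in> borel_measurable borel"
    by (rule borel_measurable_continuous_onI)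
  have "(\<lambda>y. grad g y \<bullet> b) \<in> borel_measurable borel" for b
  proof (rule borel_measurable_LIMSEQ_real)
    fix y
    have lim0: "filterlim (\<lambda>m. inverse (real (Suc m))) (at 0) sequentially"
      using LIMSEQ_inverse_real_of_nat by (auto simp: filterlim_at)
    have "((\<lambda>t. g (y + t *\<^sub>R b)) has_derivative (\<lambda>t. grad g y \<bullet> (t *\<^sub>R b))) (at 0)"
      by (rule has_derivative_compose[of "\<lambda>t. y + t *\<^sub>R b" "\<lambda>t. t *\<^sub>R b" 0 UNIV g])
        (auto intro!: derivative_eq_intros has_derivative_grad g)
    then have "((\<lambda>t. g (y + t *\<^sub>R b)) has_real_derivative (grad g y \<bullet> b)) (at 0)"
      by (simp add: has_field_derivative_def mult_commute_abs)
    then have "((\<lambda>t. (g (y + t *\<^sub>R b) - g y) / t) \<longlongrightarrow> grad g y \<bullet> b) (at 0)"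
      by (simp add: has_field_derivative_iff)
    from filterlim_compose[OF this lim0]
    show "(\<lambda>m. (g (y + inverse (real (Suc m)) *\<^sub>R b) - g y) / inverse (real (Suc m))) \<longlonglongrightarrow> grad g y \<bullet> b" .
  qed measurable
  then show ?thesis
    by (simp add: borel_measurable_euclidean_space[of "grad g"])
qed

text \<open>Compare \<open>l\<close> with the value at \<open>y - u\<close>, \<open>L u = \<nabla>g(y)\<close>, the minimizer of the quadratic upper bound at \<open>y\<close>.
  Here \<open>w \<bullet> w\<close> is the squared \<open>L\<^sup>-\<^sup>1\<close>-norm of the gradient.\<close>

lemma matrix_smooth_grad_bound:
  fixes g :: "real^'d \<Rightarrow> real"
  assumes L: "pd L" and smooth: "matrix_smooth L g" and lb: "\<And>y. l \<le> g y"
    and w: "msqrt L *v w = grad g y"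
  shows "w \<bullet> w \<le> 2 * (g y - l)"
proof -
  obtain R' where R': "msqrt L ** R' = mat 1"
    using msqrt_invertible[OF L] by (auto simp: invertible_def)
  define u where "u = R' *v w"
  have Ru: "msqrt L *v u = w"
    by (simp add: u_def matrix_vector_mul_assoc R')
  have Lu: "L *v u = grad g y"
    using msqrt_square[OF L] by (metis Ru matrix_vector_mul_assoc w)
  have "grad g y \<bullet> u = w \<bullet> w"
    using symmetric_inner_matrix_vector[of "msqrt L" w u] msqrt_psd[OF L] w Ru by (simp add: psd_def)
  moreover have "g (y - u) \<le> g y + grad g y \<bullet> ((y - u) - y) + (1/2) * ((L *v ((y - u) - y)) \<bullet> ((y - u) - y))"
    using smooth unfolding matrix_smooth_def by blast
  then have "g (y - u) \<le> g y - grad g y \<bullet> u + (1/2) * ((L *v u) \<bullet> u)"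
    by (simp add: vec.neg)
  ultimately show ?thesis
    using lb[of "y - u"] by (simp add: Lu)
qed

text \<open>With \<open>v = g + \<eta>\<close>, smoothness leaves
  \<open>- g \<bullet> (D *v v) + qnorm2 Q v / 2\<close>. After expansion in \<open>\<eta>\<close>,
  the Loewner bound on \<open>Q\<close> lets half of the \<open>D\<close>-norm of \<open>g\<close>
  absorb its \<open>Q\<close>-norm. The term linear in \<open>\<eta>\<close> is kept exact because
  its mean will be zero.\<close>

lemma matrix_smooth_preconditioned_descent:
  fixes F :: "real^'d \<Rightarrow> real"
  assumes smooth: "matrix_smooth L F" and L: "psd L" and D: "transpose D = D"
    and DLD: "loewner_le (D ** L ** D) D"
  shows "F (y - D *v (grad F y + \<eta>)) \<le> F y - qnorm2 D (grad F y) / 2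
    + ((D ** L ** D) *v grad F y - D *v grad F y) \<bullet> \<eta> + qnorm2 (D ** L ** D) \<eta> / 2"
proof -
  define g where "g = grad F y"
  define Q where "Q = D ** L ** D"
  define v where "v = g + \<eta>"
  have Q: "psd Q"
    unfolding Q_def using psd_congruence[OF L, of D] by (simp add: D)
  have qv: "(L *v (D *v v)) \<bullet> (D *v v) = qnorm2 Q v"
    using inner_transpose_mult_form[of v D L v] by (simp add: Q_def D qnorm2_def inner_commute)
  have gQ: "g \<bullet> (Q *v \<eta>) = (Q *v g) \<bullet> \<eta>"
    using Q by (intro symmetric_inner_matrix_vector) (simp add: psd_def)
  have qv': "qnorm2 Q v = qnorm2 Q g + 2 * ((Q *v g) \<bullet> \<eta>) + qnorm2 Q \<eta>"
    using gQ by (simp add: v_def qnorm2_def matrix_vector_right_distrib inner_add_left inner_add_right inner_commute)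
  have gD: "g \<bullet> (D *v v) = qnorm2 D g + (D *v g) \<bullet> \<eta>"
    by (simp add: v_def qnorm2_def matrix_vector_right_distrib inner_add_right
        symmetric_inner_matrix_vector[OF D, of g \<eta>])
  have "0 \<le> g \<bullet> ((D - Q) *v g)"
    using DLD by (simp only: loewner_le_def psd_def Q_def)
  then have qg: "qnorm2 Q g \<le> qnorm2 D g"
    by (simp add: qnorm2_def matrix_vector_mult_diff_rdistrib inner_diff_right)
  have "F (y - D *v v) \<le> F y + g \<bullet> ((y - D *v v) - y)
      + (1/2) * ((L *v ((y - D *v v) - y)) \<bullet> ((y - D *v v) - y))"
    using smooth unfolding matrix_smooth_def g_def by blast
  also have "\<dots> = F y - g \<bullet> (D *v v) + qnorm2 Q v / 2"
    using qv by (simp add: vec.neg)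
  also have "\<dots> \<le> F y - qnorm2 D g / 2 + (Q *v g - D *v g) \<bullet> \<eta> + qnorm2 Q \<eta> / 2"
    using qg unfolding gD qv' by (simp add: inner_diff_left field_simps)
  finally show ?thesis
    by (simp add: g_def Q_def v_def)
qed

section \<open>Independence of random matrices and linear forms\<close>

text \<open>The sigma-algebra generated by all variables of the family except \<open>X p\<close>. It
  takes the place of a filtration: whatever is measurable for it is independent of
  \<open>X p\<close>, and no conditional expectations have to be formed.\<close>

definition other_vars :: "'w measure \<Rightarrow> ('p \<Rightarrow> 'w \<Rightarrow> 'a::topological_space) \<Rightarrow> 'p set \<Rightarrow> 'p \<Rightarrow> 'w measure" where
  "other_vars M X I p = vimage_algebra (space M) (\<lambda>\<omega>. \<lambda>q\<in>I - {p}. X q \<omega>) (PiM (I - {p}) (\<lambda>_. borel))"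

lemma measurable_other_vars [intro]:
  assumes "q \<in> I" "q \<noteq> p"
  shows "X q \<in> borel_measurable (other_vars M X I p)"
proof -
  have "(\<lambda>\<omega>. \<lambda>q\<in>I - {p}. X q \<omega>) \<in> measurable (other_vars M X I p) (PiM (I - {p}) (\<lambda>_. borel))"
    unfolding other_vars_def by (rule measurable_vimage_algebra1) (auto simp: space_PiM)
  from measurable_compose[OF this measurable_component_singleton[of q]] show ?thesis
    using assms by simp
qed

context prob_space
begin

lemma other_vars_subalgebra:
  assumes "indep_vars (\<lambda>_. borel) X I"
  shows "subalgebra M (other_vars M X I p)"
proof -
  have "(\<lambda>\<omega>. \<lambda>q\<in>I - {p}. X q \<omega>) \<in> measurable M (PiM (I - {p}) (\<lambda>_. borel))"
    using assms by (intro measurable_restrict) (auto simp: indep_vars_def)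
  then show ?thesis
    unfolding subalgebra_def other_vars_def by (auto simp: sets_vimage_algebra2 space_PiM)
qed

text \<open>Grouping the family into \<open>{p}\<close> and \<open>I - {p}\<close> gives two
  independent sigma-algebras. Those generated by \<open>\<phi> (X p)\<close> and by \<open>Y\<close>
  are contained in them, and independence passes to smaller families.\<close>

lemma indep_var_other_vars:
  fixes \<phi> :: "'b::topological_space \<Rightarrow> 'e::topological_space"
  assumes ind: "indep_vars (\<lambda>_. borel) X I" and p: "p \<in> I"
    and Y: "Y \<in> borel_measurable (other_vars M X I p)"
    and \<phi>: "\<phi> \<in> borel_measurable borel"
  shows "indep_var borel (\<lambda>\<omega>. \<phi> (X p \<omega>)) borel Y"
proof -
  let ?g = "\<lambda>\<omega>. \<lambda>q\<in>I - {p}. X q \<omega>" and ?P = "PiM (I - {p}) (\<lambda>_. borel)"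
    and ?h = "\<lambda>\<omega>. \<lambda>q\<in>{p}. X q \<omega>" and ?Q = "PiM {p} (\<lambda>_. borel)"
  have Xp: "X p \<in> borel_measurable M"
    using ind p by (auto simp: indep_vars_def)
  have "indep_var (PiM {p} (\<lambda>_. borel)) (\<lambda>\<omega>. \<lambda>q\<in>{p}. X q \<omega>) ?P ?g"
    using p by (intro indep_var_restrict[OF ind]) auto
  then have ind2: "indep_set (sigma_sets (space M) {?h -` A \<inter> space M |A. A \<in> sets ?Q})
      (sigma_sets (space M) {?g -` A \<inter> space M |A. A \<in> sets ?P})"
    by (simp add: indep_var_eq)
  have "{(\<lambda>\<omega>. \<phi> (X p \<omega>)) -` A \<inter> space M |A. A \<in> sets borel} \<subseteq> {?h -` A \<inter> space M |A. A \<in> sets ?Q}"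
  proof safe
    fix A :: "'e set" assume "A \<in> sets borel"
    moreover have "(\<lambda>s. \<phi> (s p)) \<in> borel_measurable ?Q"
      using \<phi> by measurable
    ultimately have "(\<lambda>s. \<phi> (s p)) -` A \<inter> space ?Q \<in> sets ?Q"
      by (blast intro: measurable_sets)
    moreover have "(\<lambda>\<omega>. \<phi> (X p \<omega>)) -` A \<inter> space M = ?h -` ((\<lambda>s. \<phi> (s p)) -` A \<inter> space ?Q) \<inter> space M"
      by (auto simp: space_PiM)
    ultimately show "\<exists>A'. (\<lambda>\<omega>. \<phi> (X p \<omega>)) -` A \<inter> space M = ?h -` A' \<inter> space M \<and> A' \<in> sets ?Q"
      by blast
  qed
  then have sub1: "sigma_sets (space M) {(\<lambda>\<omega>. \<phi> (X p \<omega>)) -` A \<inter> space M |A. A \<in> sets borel}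
      \<subseteq> sigma_sets (space M) {?h -` A \<inter> space M |A. A \<in> sets ?Q}"
    by (rule sigma_sets_subseteq)
  have "{Y -` A \<inter> space M |A. A \<in> sets borel} \<subseteq> sets (other_vars M X I p)"
    using measurable_sets[OF Y] by (auto simp: other_vars_def)
  then have "sigma_sets (space M) {Y -` A \<inter> space M |A. A \<in> sets borel} \<subseteq> sets (other_vars M X I p)"
    using sets.sigma_sets_subset[of _ "other_vars M X I p"] by (simp add: other_vars_def)
  also have "\<dots> = sigma_sets (space M) {?g -` A \<inter> space M |A. A \<in> sets ?P}"
    by (simp add: other_vars_def vimage_algebra_def sets_measure_of_conv) blast
  finally have "indep_set (sigma_sets (space M) {(\<lambda>\<omega>. \<phi> (X p \<omega>)) -` A \<inter> space M |A. A \<in> sets borel})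
      (sigma_sets (space M) {Y -` A \<inter> space M |A. A \<in> sets borel})"
    using ind2 sub1 unfolding indep_set_def by (elim indep_sets_mono_sets) (auto split: bool.split)
  then show ?thesis
    using measurable_compose[OF Xp \<phi>] measurable_from_subalg[OF other_vars_subalgebra[OF ind] Y]
    by (simp add: indep_var_eq)
qed

end

section \<open>Measurability and integrability of matrix-vector expressions\<close>

lemma borel_measurable_vec_nth:
  fixes v :: "'w \<Rightarrow> ('a::euclidean_space)^'d"
  assumes "v \<in> borel_measurable N"
  shows "(\<lambda>\<omega>. v \<omega> $ a) \<in> borel_measurable N"
  by (rule measurable_compose[OF assms borel_measurable_continuous_onI]) (intro continuous_intros)

lemma borel_measurable_matrix_vector_mult:
  fixes A :: "'w \<Rightarrow> real^'d^'e" and v :: "'w \<Rightarrow> real^'d"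
  assumes [measurable]: "A \<in> borel_measurable N" "v \<in> borel_measurable N"
  shows "(\<lambda>\<omega>. A \<omega> *v v \<omega>) \<in> borel_measurable N"
proof -
  have "continuous_on UNIV (\<lambda>p. fst p *v snd p :: real^'e)"
    unfolding matrix_vector_mult_def by (intro continuous_on_vec_lambda continuous_intros)
  then show ?thesis
    by (rule borel_measurable_continuous_Pair[OF assms])
qed

lemma borel_measurable_matrix_vector_mult_const:
  fixes A :: "real^'d^'e" and v :: "'w \<Rightarrow> real^'d"
  assumes "v \<in> borel_measurable N"
  shows "(\<lambda>\<omega>. A *v v \<omega>) \<in> borel_measurable N"
  using assms by (intro borel_measurable_matrix_vector_mult) simp_all

lemma inner_matrix_vector_expand:
  fixes A :: "real^'d^'d"
  shows "u \<bullet> (A *v v) = (\<Sum>a\<in>UNIV. \<Sum>b\<in>UNIV. A $ a $ b * (u $ a * v $ b))"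
  by (simp add: inner_vec_def matrix_vector_mult_def sum_distrib_left mult_ac)

lemma integrable_vec_nth:
  fixes v :: "'w \<Rightarrow> ('a::euclidean_space)^'d"
  assumes "integrable N v"
  shows "integrable N (\<lambda>\<omega>. v \<omega> $ a)" "integral\<^sup>L N (\<lambda>\<omega>. v \<omega> $ a) = integral\<^sup>L N v $ a"
  using integrable_bounded_linear[OF bounded_linear_vec_nth assms]
    integral_bounded_linear[OF bounded_linear_vec_nth assms] by auto

lemma integrable_mult_square_integrable:
  fixes u v :: "'w \<Rightarrow> real^'d"
  assumes [measurable]: "u \<in> borel_measurable N" "v \<in> borel_measurable N"
    and uv: "integrable N (\<lambda>\<omega>. u \<omega> \<bullet> u \<omega>)" "integrable N (\<lambda>\<omega>. v \<omega> \<bullet> v \<omega>)"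
  shows "integrable N (\<lambda>\<omega>. u \<omega> $ a * v \<omega> $ b)"
proof (rule Bochner_Integration.integrable_bound[OF Bochner_Integration.integrable_add[OF uv]])
  show "(\<lambda>\<omega>. u \<omega> $ a * v \<omega> $ b) \<in> borel_measurable N"
    by (intro borel_measurable_times borel_measurable_vec_nth assms)
  have "\<bar>y $ a * z $ b\<bar> \<le> y \<bullet> y + z \<bullet> z" for y z :: "real^'d"
  proof -
    have "\<bar>y $ a * z $ b\<bar> \<le> norm y * norm z"
      unfolding abs_mult by (intro mult_mono component_le_norm_cart) auto
    also have "\<dots> \<le> (norm y)\<^sup>2 + (norm z)\<^sup>2"
      using sum_squares_bound[of "norm y" "norm z"] mult_nonneg_nonneg[OF norm_ge_zero[of y] norm_ge_zero[of z]] by linarith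
    finally show ?thesis by (simp add: power2_norm_eq_inner)
  qed
  then show "AE \<omega> in N. norm (u \<omega> $ a * v \<omega> $ b) \<le> norm (u \<omega> \<bullet> u \<omega> + v \<omega> \<bullet> v \<omega>)"
    by (simp add: real_norm_def)
qed

lemma integrable_inner_matrix_const:
  fixes u v :: "'w \<Rightarrow> real^'d" and A :: "real^'d^'d"
  assumes "\<And>a b. integrable N (\<lambda>\<omega>. u \<omega> $ a * v \<omega> $ b)"
  shows "integrable N (\<lambda>\<omega>. u \<omega> \<bullet> (A *v v \<omega>))"
  unfolding inner_matrix_vector_expand
  by (intro Bochner_Integration.integrable_sum integrable_mult_right assms)

lemma square_integrable_matrix_mult:
  fixes v :: "'w \<Rightarrow> real^'d" and A :: "real^'d^'d"
  assumes "v \<in> borel_measurable N" "integrable N (\<lambda>\<omega>. v \<omega> \<bullet> v \<omega>)"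
  shows "integrable N (\<lambda>\<omega>. (A *v v \<omega>) \<bullet> (A *v v \<omega>))"
proof -
  have "integrable N (\<lambda>\<omega>. v \<omega> \<bullet> ((transpose A ** A) *v v \<omega>))"
    by (intro integrable_inner_matrix_const integrable_mult_square_integrable assms)
  moreover have "y \<bullet> ((transpose A ** A) *v y) = (A *v y) \<bullet> (A *v y)" for y
    by (metis dot_lmul_matrix inner_commute matrix_vector_mul_assoc transpose_matrix_vector)
  ultimately show ?thesis
    by (simp only:)
qed

lemma square_integrable_sum:
  fixes v :: "'p \<Rightarrow> 'w \<Rightarrow> real^'d"
  assumes "\<And>p. p \<in> P \<Longrightarrow> v p \<in> borel_measurable N" "\<And>p. p \<in> P \<Longrightarrow> integrable N (\<lambda>\<omega>. v p \<omega> \<bullet> v p \<omega>)"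
  shows "integrable N (\<lambda>\<omega>. (\<Sum>p\<in>P. v p \<omega>) \<bullet> (\<Sum>p\<in>P. v p \<omega>))"
proof -
  have "integrable N (\<lambda>\<omega>. v p \<omega> \<bullet> (mat 1 *v v q \<omega>))" if "p \<in> P" "q \<in> P" for p q
    using assms that by (intro integrable_inner_matrix_const integrable_mult_square_integrable) auto
  then show ?thesis
    by (auto simp: inner_sum_left inner_sum_right intro!: Bochner_Integration.integrable_sum)
qed

section \<open>Expectations of bilinear forms in random matrices\<close>

context prob_space
begin

text \<open>Expand the form into entries: each entry of \<open>\<phi> (X p)\<close> is independent
  of the product \<open>u $ a * v $ b\<close>, so expectations factor. Integrability is asked of
  these products rather than of squares of \<open>u\<close> and \<open>v\<close>, since the cross
  terms of the noise offer only the former.\<close>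

lemma expectation_inner_matrix_vector_indep:
  fixes X :: "'p \<Rightarrow> 'a \<Rightarrow> real^'d^'d" and \<phi> :: "real^'d^'d \<Rightarrow> real^'d^'d"
  assumes ind: "indep_vars (\<lambda>_. borel) X I" and p: "p \<in> I"
    and \<phi>: "\<phi> \<in> borel_measurable borel" "integrable M (\<lambda>\<omega>. \<phi> (X p \<omega>))"
    and uv: "u \<in> borel_measurable (other_vars M X I p)" "v \<in> borel_measurable (other_vars M X I p)"
    and int: "\<And>a b. integrable M (\<lambda>\<omega>. u \<omega> $ a * v \<omega> $ b)"
  shows "integrable M (\<lambda>\<omega>. u \<omega> \<bullet> (\<phi> (X p \<omega>) *v v \<omega>))"
    and "expectation (\<lambda>\<omega>. u \<omega> \<bullet> (\<phi> (X p \<omega>) *v v \<omega>))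
       = expectation (\<lambda>\<omega>. u \<omega> \<bullet> (expectation (\<lambda>\<omega>. \<phi> (X p \<omega>)) *v v \<omega>))"
proof -
  have iv: "indep_var borel (\<lambda>\<omega>. \<phi> (X p \<omega>) $ a $ b) borel (\<lambda>\<omega>. u \<omega> $ a * v \<omega> $ b)" for a b
    by (intro indep_var_other_vars[OF ind p, where \<phi> = "\<lambda>s. \<phi> s $ a $ b"]
        borel_measurable_times borel_measurable_vec_nth \<phi> uv)
  note i1 = integrable_vec_nth[OF integrable_vec_nth(1)[OF \<phi>(2)]]
  note e1 = integrable_vec_nth(2)[OF integrable_vec_nth(1)[OF \<phi>(2)], unfolded integrable_vec_nth(2)[OF \<phi>(2)]]
  note prod = indep_var_integrable[OF iv i1(1) int] indep_var_lebesgue_integral[OF iv i1(1) int, unfolded e1]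
  show "integrable M (\<lambda>\<omega>. u \<omega> \<bullet> (\<phi> (X p \<omega>) *v v \<omega>))"
    unfolding inner_matrix_vector_expand by (intro Bochner_Integration.integrable_sum prod)
  show "expectation (\<lambda>\<omega>. u \<omega> \<bullet> (\<phi> (X p \<omega>) *v v \<omega>))
       = expectation (\<lambda>\<omega>. u \<omega> \<bullet> (expectation (\<lambda>\<omega>. \<phi> (X p \<omega>)) *v v \<omega>))"
    unfolding inner_matrix_vector_expand
    by (simp only: prod int Bochner_Integration.integral_sum Bochner_Integration.integrable_sum
        integrable_mult_right integral_mult_right_zero)
qed

end

lemma integral_inner_matrix_vector:
  fixes A :: "'w \<Rightarrow> real^'d^'d"
  assumes A: "integrable N A"
  shows "integral\<^sup>L N (\<lambda>\<omega>. u \<bullet> (A \<omega> *v v)) = u \<bullet> (integral\<^sup>L N A *v v)"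
  unfolding inner_matrix_vector_expand
  by (simp only: Bochner_Integration.integral_sum Bochner_Integration.integrable_sum
      integrable_mult_left integral_mult_left_zero
      integrable_vec_nth[OF integrable_vec_nth(1)[OF A]] integrable_vec_nth(2)[OF A])

text \<open>Symmetry and nonnegativity are both statements about the scalar forms
  \<open>u \<bullet> (A *v v)\<close>, and these commute with the integral.\<close>

lemma psd_integral:
  fixes A :: "'w \<Rightarrow> real^'d^'d"
  assumes A: "integrable N A" and psd: "AE \<omega> in N. psd (A \<omega>)"
  shows "psd (integral\<^sup>L N A)"
  unfolding psd_def
proof (intro conjI allI)
  have meas: "(\<lambda>\<omega>. u \<bullet> (A \<omega> *v v)) \<in> borel_measurable N" for u v
    using A by (intro borel_measurable_inner borel_measurable_matrix_vector_mult) auto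
  show "transpose (integral\<^sup>L N A) = integral\<^sup>L N A"
  proof (rule transpose_eqI)
    fix u v :: "real^'d"
    have "AE \<omega> in N. u \<bullet> (A \<omega> *v v) = v \<bullet> (A \<omega> *v u)"
      using psd by eventually_elim (metis inner_commute psd_def symmetric_inner_matrix_vector)
    then show "u \<bullet> (integral\<^sup>L N A *v v) = v \<bullet> (integral\<^sup>L N A *v u)"
      unfolding integral_inner_matrix_vector[OF A, symmetric]
      by (intro integral_cong_AE meas)
  qed
  show "0 \<le> x \<bullet> (integral\<^sup>L N A *v x)" for x
    unfolding integral_inner_matrix_vector[OF A, symmetric]
    using psd by (intro integral_nonneg_AE) (auto simp: psd_def)
qed

context prob_space
begin

lemma expectation_inner_centered_eq_0:
  fixes X :: "'p \<Rightarrow> 'a \<Rightarrow> real^'d^'d"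
  assumes ind: "indep_vars (\<lambda>_. borel) X I" and p: "p \<in> I"
    and X: "integrable M (X p)" "expectation (X p) = mat 1"
    and uv: "u \<in> borel_measurable (other_vars M X I p)" "v \<in> borel_measurable (other_vars M X I p)"
    and int: "\<And>a b. integrable M (\<lambda>\<omega>. u \<omega> $ a * v \<omega> $ b)"
  shows "integrable M (\<lambda>\<omega>. u \<omega> \<bullet> ((X p \<omega> - mat 1) *v v \<omega>))"
    and "expectation (\<lambda>\<omega>. u \<omega> \<bullet> ((X p \<omega> - mat 1) *v v \<omega>)) = 0"
proof -
  have m: "(\<lambda>s. s - mat 1 :: real^'d^'d) \<in> borel_measurable borel"
    by measurable
  have i: "integrable M (\<lambda>\<omega>. X p \<omega> - mat 1)" and e: "expectation (\<lambda>\<omega>. X p \<omega> - mat 1) = 0"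
    using X by (simp_all add: prob_space)
  show "integrable M (\<lambda>\<omega>. u \<omega> \<bullet> ((X p \<omega> - mat 1) *v v \<omega>))"
    by (rule expectation_inner_matrix_vector_indep(1)[OF ind p m i uv int])
  show "expectation (\<lambda>\<omega>. u \<omega> \<bullet> ((X p \<omega> - mat 1) *v v \<omega>)) = 0"
    using expectation_inner_matrix_vector_indep(2)[OF ind p m i uv int] by (simp add: e)
qed

lemma borel_measurable_other_vars_imp:
  assumes "indep_vars (\<lambda>_. borel) X I" "Y \<in> borel_measurable (other_vars M X I p)"
  shows "Y \<in> borel_measurable M"
  using assms(2) by (rule measurable_from_subalg[OF other_vars_subalgebra[OF assms(1)]])

text \<open>Serves the linear noise term of the descent inequality, where one vector
  \<open>u\<close> is independent of each \<open>X p\<close> of the current step.\<close>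

lemma expectation_inner_centered_sum_eq_0:
  fixes X :: "'p \<Rightarrow> 'a \<Rightarrow> real^'d^'d"
  assumes ind: "indep_vars (\<lambda>_. borel) X I" and P: "P \<subseteq> I"
    and X: "\<And>p. p \<in> P \<Longrightarrow> integrable M (X p)" "\<And>p. p \<in> P \<Longrightarrow> expectation (X p) = mat 1"
    and u: "\<And>p. p \<in> P \<Longrightarrow> u \<in> borel_measurable (other_vars M X I p)" "integrable M (\<lambda>\<omega>. u \<omega> \<bullet> u \<omega>)"
    and G: "\<And>p. p \<in> P \<Longrightarrow> G p \<in> borel_measurable (other_vars M X I p)"
      "\<And>p. p \<in> P \<Longrightarrow> integrable M (\<lambda>\<omega>. G p \<omega> \<bullet> G p \<omega>)"
  shows "integrable M (\<lambda>\<omega>. u \<omega> \<bullet> (\<Sum>p\<in>P. (X p \<omega> - mat 1) *v G p \<omega>))"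
    and "expectation (\<lambda>\<omega>. u \<omega> \<bullet> (\<Sum>p\<in>P. (X p \<omega> - mat 1) *v G p \<omega>)) = 0"
proof -
  have summand: "integrable M (\<lambda>\<omega>. u \<omega> \<bullet> ((X p \<omega> - mat 1) *v G p \<omega>))"
    "expectation (\<lambda>\<omega>. u \<omega> \<bullet> ((X p \<omega> - mat 1) *v G p \<omega>)) = 0" if p: "p \<in> P" for p
  proof -
    have pI: "p \<in> I" using P p by auto
    have "integrable M (\<lambda>\<omega>. u \<omega> $ a * G p \<omega> $ b)" for a b
      using u G p borel_measurable_other_vars_imp[OF ind]
      by (intro integrable_mult_square_integrable) blast+
    note expectation_inner_centered_eq_0[OF ind pI X(1)[OF p] X(2)[OF p] u(1)[OF p] G(1)[OF p] this]
    then show "integrable M (\<lambda>\<omega>. u \<omega> \<bullet> ((X p \<omega> - mat 1) *v G p \<omega>))"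
      "expectation (\<lambda>\<omega>. u \<omega> \<bullet> ((X p \<omega> - mat 1) *v G p \<omega>)) = 0" by blast+
  qed
  show "integrable M (\<lambda>\<omega>. u \<omega> \<bullet> (\<Sum>p\<in>P. (X p \<omega> - mat 1) *v G p \<omega>))"
    unfolding inner_sum_right by (intro Bochner_Integration.integrable_sum summand)
  show "expectation (\<lambda>\<omega>. u \<omega> \<bullet> (\<Sum>p\<in>P. (X p \<omega> - mat 1) *v G p \<omega>)) = 0"
    unfolding inner_sum_right by (simp add: Bochner_Integration.integral_sum summand)
qed

text \<open>The cross terms vanish because one of the two centered factors is independent of everything else.\<close>

lemma expectation_qnorm2_centered_sum:
  fixes X :: "'p \<Rightarrow> 'a \<Rightarrow> real^'d^'d"
  assumes ind: "indep_vars (\<lambda>_. borel) X I" and P: "P \<subseteq> I" "finite P"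
    and X: "\<And>p. p \<in> P \<Longrightarrow> integrable M (X p)" "\<And>p. p \<in> P \<Longrightarrow> expectation (X p) = mat 1"
    and G: "\<And>p q. p \<in> P \<Longrightarrow> q \<in> P \<Longrightarrow> G q \<in> borel_measurable (other_vars M X I p)"
      "\<And>p. p \<in> P \<Longrightarrow> integrable M (\<lambda>\<omega>. G p \<omega> \<bullet> G p \<omega>)"
    and Q: "transpose Q = Q"
    and var: "\<And>p. p \<in> P \<Longrightarrow> integrable M (\<lambda>\<omega>. qnorm2 Q ((X p \<omega> - mat 1) *v G p \<omega>))"
  shows "integrable M (\<lambda>\<omega>. qnorm2 Q (\<Sum>p\<in>P. (X p \<omega> - mat 1) *v G p \<omega>))"
    and "expectation (\<lambda>\<omega>. qnorm2 Q (\<Sum>p\<in>P. (X p \<omega> - mat 1) *v G p \<omega>))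
       = (\<Sum>p\<in>P. expectation (\<lambda>\<omega>. qnorm2 Q ((X p \<omega> - mat 1) *v G p \<omega>)))"
proof -
  define \<xi> where "\<xi> p \<omega> = (X p \<omega> - mat 1) *v G p \<omega>" for p \<omega>
  have GM: "G p \<in> borel_measurable M" if "p \<in> P" for p
    using borel_measurable_other_vars_imp[OF ind G(1)[OF that that]] .
  have cross: "integrable M (\<lambda>\<omega>. (Q *v \<xi> q \<omega>) \<bullet> \<xi> p \<omega>)" "expectation (\<lambda>\<omega>. (Q *v \<xi> q \<omega>) \<bullet> \<xi> p \<omega>) = 0"
    if p: "p \<in> P" and q: "q \<in> P" and pq: "q \<noteq> p" for p q
  proof -
    have pI: "p \<in> I" and qI: "q \<in> I" using p q P by auto
    have Xq: "X q \<in> borel_measurable (other_vars M X I p)"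
      using qI pq by blast
    have u: "(\<lambda>\<omega>. Q *v \<xi> q \<omega>) \<in> borel_measurable (other_vars M X I p)"
      unfolding \<xi>_def using Xq G(1)[OF p q]
      by (intro borel_measurable_matrix_vector_mult_const borel_measurable_matrix_vector_mult borel_measurable_diff) auto
    \<comment> \<open>Square integrability of \<open>Q *v \<xi> q\<close> is not among the
      hypotheses. Instead the roles are exchanged: \<open>X q\<close> is now the independent matrix,
      the left vector is the constant \<open>Q *v axis a 1\<close>, and the scalar
      \<open>G p $ b\<close> is moved into the right vector.\<close>
    have "integrable M (\<lambda>\<omega>. (Q *v \<xi> q \<omega>) $ a * G p \<omega> $ b)" for a b
    proof -
      have "integrable M (\<lambda>\<omega>. (Q *v axis a 1) \<bullet> ((X q \<omega> - mat 1) *v ((G p \<omega> $ b) *\<^sub>R G q \<omega>)))"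
      proof (rule expectation_inner_centered_eq_0(1)[OF ind qI X(1)[OF q] X(2)[OF q]])
        show "(\<lambda>\<omega>. (G p \<omega> $ b) *\<^sub>R G q \<omega>) \<in> borel_measurable (other_vars M X I q)"
          using G(1)[OF q q] G(1)[OF q p] by (intro borel_measurable_scaleR borel_measurable_vec_nth)
        have "integrable M (\<lambda>\<omega>. G p \<omega> $ b * G q \<omega> $ b')" for b'
          using p q by (intro integrable_mult_square_integrable GM G)
        then show "integrable M (\<lambda>\<omega>. (Q *v axis a 1) $ a' * ((G p \<omega> $ b) *\<^sub>R G q \<omega>) $ b')" for a' b'
          by simp
      qed simp
      moreover have "(Q *v axis a 1) \<bullet> (N *v (c *\<^sub>R g)) = (Q *v (N *v g)) $ a * c" for N :: "real^'d^'d" and g c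
        by (simp add: matrix_vector_mult_scaleR inner_axis' mult.commute
            flip: symmetric_inner_matrix_vector[OF Q, of "axis a 1" "N *v g"])
      ultimately show ?thesis
        by (simp add: \<xi>_def)
    qed
    note * = expectation_inner_centered_eq_0[OF ind pI X(1)[OF p] X(2)[OF p] u G(1)[OF p p] this, folded \<xi>_def]
    show "integrable M (\<lambda>\<omega>. (Q *v \<xi> q \<omega>) \<bullet> \<xi> p \<omega>)" "expectation (\<lambda>\<omega>. (Q *v \<xi> q \<omega>) \<bullet> \<xi> p \<omega>) = 0"
      by (fact *)+
  qed
  have diag: "integrable M (\<lambda>\<omega>. (Q *v \<xi> p \<omega>) \<bullet> \<xi> p \<omega>)" if "p \<in> P" for p
    using var[OF that] by (simp add: qnorm2_def \<xi>_def inner_commute)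
  have int: "integrable M (\<lambda>\<omega>. (Q *v \<xi> q \<omega>) \<bullet> \<xi> p \<omega>)" if "p \<in> P" "q \<in> P" for p q
    using cross[OF that] diag[OF that(1)] by (cases "q = p") auto
  have expand: "qnorm2 Q (\<Sum>p\<in>P. \<xi> p \<omega>) = (\<Sum>p\<in>P. \<Sum>q\<in>P. (Q *v \<xi> q \<omega>) \<bullet> \<xi> p \<omega>)" for \<omega>
    unfolding qnorm2_def linear_sum[OF matrix_vector_mul_linear]
    by (subst inner_commute, unfold inner_sum_left inner_sum_right, rule sum.swap)
  show "integrable M (\<lambda>\<omega>. qnorm2 Q (\<Sum>p\<in>P. (X p \<omega> - mat 1) *v G p \<omega>))"
    unfolding \<xi>_def[symmetric] expand by (intro Bochner_Integration.integrable_sum int)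
  have "expectation (\<lambda>\<omega>. qnorm2 Q (\<Sum>p\<in>P. \<xi> p \<omega>)) = (\<Sum>p\<in>P. expectation (\<lambda>\<omega>. \<Sum>q\<in>P. (Q *v \<xi> q \<omega>) \<bullet> \<xi> p \<omega>))"
    unfolding expand by (rule Bochner_Integration.integral_sum) (intro Bochner_Integration.integrable_sum int)
  also have "\<dots> = (\<Sum>p\<in>P. \<Sum>q\<in>P. expectation (\<lambda>\<omega>. (Q *v \<xi> q \<omega>) \<bullet> \<xi> p \<omega>))"
    by (rule sum.cong[OF refl], rule Bochner_Integration.integral_sum, rule int)
  also have "\<dots> = (\<Sum>p\<in>P. \<Sum>q\<in>P. if q = p then expectation (\<lambda>\<omega>. (Q *v \<xi> p \<omega>) \<bullet> \<xi> p \<omega>) else 0)"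
    using cross by (intro sum.cong) auto
  also have "\<dots> = (\<Sum>p\<in>P. expectation (\<lambda>\<omega>. qnorm2 Q (\<xi> p \<omega>)))"
    using P(2) by (simp add: qnorm2_def inner_commute)
  finally show "expectation (\<lambda>\<omega>. qnorm2 Q (\<Sum>p\<in>P. (X p \<omega> - mat 1) *v G p \<omega>))
       = (\<Sum>p\<in>P. expectation (\<lambda>\<omega>. qnorm2 Q ((X p \<omega> - mat 1) *v G p \<omega>)))"
    unfolding \<xi>_def .
qed

end

section \<open>A weighted recursion and the variance of one noise term\<close>

text \<open>Multiplying step \<open>k\<close> by the power \<open>K - Suc k\<close> of
  \<open>q = 1 + a\<close> makes the recursion telescope. The minimum and \<open>b\<close> enter
  with the same total weight \<open>W K\<close>, so \<open>b\<close> appears in the result without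
  an exponential factor.\<close>

lemma weighted_descent_min_le:
  fixes \<delta> r :: "nat \<Rightarrow> real"
  assumes step: "\<And>k. \<delta> (Suc k) \<le> (1 + a) * \<delta> k - r k / 2 + b"
    and a: "0 \<le> a" and \<delta>: "\<And>k. 0 \<le> \<delta> k" and K: "1 \<le> K"
  shows "Min (r ` {..<K}) \<le> 2 * (1 + a) ^ K * \<delta> 0 / real K + 2 * b"
proof -
  define m where "m = Min (r ` {..<K})"
  define q where "q = 1 + a"
  have q: "q \<ge> 1" using a by (simp add: q_def)
  define W where "W j = (\<Sum>k<j. q ^ (K - Suc k))" for j
  have m: "m \<le> r k" if "k < K" for k
    using that by (auto simp: m_def)
  have ind: "q ^ (K - j) * \<delta> j \<le> q ^ K * \<delta> 0 - (m / 2 - b) * W j" if "j \<le> K" for j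
    using that
  proof (induction j)
    case (Suc j)
    have "\<delta> (Suc j) \<le> q * \<delta> j - (m / 2 - b)"
      using step[of j] m[of j] Suc.prems by (simp add: q_def)
    then have "q ^ (K - Suc j) * \<delta> (Suc j) \<le> q ^ (K - Suc j) * (q * \<delta> j - (m / 2 - b))"
      using q by (intro mult_left_mono) auto
    also have "\<dots> = q ^ (K - j) * \<delta> j - (m / 2 - b) * q ^ (K - Suc j)"
    proof -
      have "K - j = Suc (K - Suc j)" using Suc.prems by simp
      then show ?thesis by (simp add: algebra_simps)
    qed
    also have "\<dots> \<le> q ^ K * \<delta> 0 - (m / 2 - b) * W (Suc j)"
      using Suc.IH Suc.prems by (simp add: W_def algebra_simps)
    finally show ?case .
  qed (simp add: W_def)
  have WK: "W K \<ge> real K"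
  proof -
    have "(\<Sum>k<K. 1) \<le> W K"
      unfolding W_def using q by (intro sum_mono) auto
    then show ?thesis by simp
  qed
  have "(m / 2 - b) * W K \<le> q ^ K * \<delta> 0"
    using ind[of K] \<delta>[of K] by simp
  \<comment> \<open>The factor \<open>m / 2 - b\<close> may have either sign: if nonnegative,
    \<open>W K\<close> can be lowered to \<open>K\<close>; if negative, the left side is below
    0.\<close>
  moreover have "(m / 2 - b) * real K \<le> max 0 ((m / 2 - b) * W K)"
    using WK by (cases "m / 2 - b \<ge> 0") (auto intro: mult_left_mono simp: le_max_iff_disj mult_le_0_iff)
  moreover have "0 \<le> q ^ K * \<delta> 0"
    using q \<delta>[of 0] by simp
  ultimately have "(m / 2 - b) * real K \<le> q ^ K * \<delta> 0"
    by linarith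
  then show ?thesis
    using K by (simp add: m_def[symmetric] q_def[symmetric] field_simps)
qed

text \<open>Symmetry of \<open>s\<close> turns the matrix inside the definition of \<lambda>_D into
  a congruence of \<open>Q\<close>, hence positive semidefinite when \<open>Q\<close> is. Its
  quadratic form at \<open>w\<close> is the squared \<open>Q\<close>-norm of
  \<open>(s - mat 1) *v (R *v w)\<close>.\<close>

lemma sandwich_eq_congruence:
  fixes R Q s :: "real^'d^'d"
  assumes R: "transpose R = R" and s: "transpose s = s"
  shows "R ** (s - mat 1) ** Q ** (s - mat 1) ** R = transpose ((s - mat 1) ** R) ** Q ** ((s - mat 1) ** R)"
proof -
  have "transpose (s - mat 1) = s - mat 1"
    using s by (simp add: transpose_def vec_eq_iff mat_def)
  then show ?thesis
    by (simp add: matrix_transpose_mul R matrix_mul_assoc)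
qed

text \<open>Almost surely the squared \<open>Q\<close>-norm is the form of
  \<open>\<phi> (X p)\<close> at \<open>W\<close>. Since \<open>W\<close> is independent of
  \<open>X p\<close>, the random matrix may be replaced by its mean, whose form is bounded by its
  largest eigenvalue.\<close>

lemma (in prob_space) expectation_qnorm2_centered_le:
  fixes X :: "'p \<Rightarrow> 'a \<Rightarrow> real^'d^'d" and R Q :: "real^'d^'d"
  defines "\<phi> \<equiv> \<lambda>s. R ** (s - mat 1) ** Q ** (s - mat 1) ** R"
  assumes ind: "indep_vars (\<lambda>_. borel) X I" and p: "p \<in> I"
    and R: "transpose R = R" and Q: "psd Q"
    and X_sym: "AE \<omega> in M. transpose (X p \<omega>) = X p \<omega>"
    and \<phi>_int: "integrable M (\<lambda>\<omega>. \<phi> (X p \<omega>))"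
    and W: "W \<in> borel_measurable (other_vars M X I p)" "integrable M (\<lambda>\<omega>. W \<omega> \<bullet> W \<omega>)"
  shows "integrable M (\<lambda>\<omega>. qnorm2 Q ((X p \<omega> - mat 1) *v (R *v W \<omega>)))"
    and "expectation (\<lambda>\<omega>. qnorm2 Q ((X p \<omega> - mat 1) *v (R *v W \<omega>)))
       \<le> lambda_max (expectation (\<lambda>\<omega>. \<phi> (X p \<omega>))) * expectation (\<lambda>\<omega>. W \<omega> \<bullet> W \<omega>)"
    and "0 \<le> lambda_max (expectation (\<lambda>\<omega>. \<phi> (X p \<omega>)))"
proof -
  define \<Lambda> where "\<Lambda> = expectation (\<lambda>\<omega>. \<phi> (X p \<omega>))"
  have "continuous_on UNIV \<phi>"
    unfolding \<phi>_def matrix_matrix_mult_def by (intro continuous_on_vec_lambda continuous_intros)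
  then have \<phi>_meas: "\<phi> \<in> borel_measurable borel"
    by (rule borel_measurable_continuous_onI)
  have psd\<Lambda>: "psd \<Lambda>"
    unfolding \<Lambda>_def
  proof (rule psd_integral[OF \<phi>_int])
    show "AE \<omega> in M. psd (\<phi> (X p \<omega>))"
      using X_sym
    proof eventually_elim
      case (elim \<omega>)
      then show ?case
        unfolding \<phi>_def sandwich_eq_congruence[OF R elim] by (intro psd_congruence Q)
    qed
  qed
  then show "0 \<le> lambda_max (expectation (\<lambda>\<omega>. \<phi> (X p \<omega>)))"
    unfolding \<Lambda>_def by (rule lambda_max_nonneg)
  have WM: "W \<in> borel_measurable M"
    by (rule borel_measurable_other_vars_imp[OF ind W(1)])
  have XM: "X p \<in> borel_measurable M"
    using ind p by (auto simp: indep_vars_def)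
  have WW: "integrable M (\<lambda>\<omega>. W \<omega> $ a * W \<omega> $ b)" for a b
    by (intro integrable_mult_square_integrable WM W)
  have AEeq: "AE \<omega> in M. W \<omega> \<bullet> (\<phi> (X p \<omega>) *v W \<omega>) = qnorm2 Q ((X p \<omega> - mat 1) *v (R *v W \<omega>))"
    using X_sym
  proof eventually_elim
    case (elim \<omega>)
    show ?case
      unfolding \<phi>_def sandwich_eq_congruence[OF R elim] inner_transpose_mult_form
      by (simp add: qnorm2_def matrix_vector_mul_assoc)
  qed
  have qmeas: "(\<lambda>\<omega>. qnorm2 Q ((X p \<omega> - mat 1) *v (R *v W \<omega>))) \<in> borel_measurable M"
    unfolding qnorm2_def using WM XM
    by (intro borel_measurable_inner borel_measurable_matrix_vector_mult borel_measurable_diff) auto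
  note E = expectation_inner_matrix_vector_indep[OF ind p \<phi>_meas \<phi>_int W(1) W(1) WW, folded \<Lambda>_def]
  show "integrable M (\<lambda>\<omega>. qnorm2 Q ((X p \<omega> - mat 1) *v (R *v W \<omega>)))"
    by (rule integrable_cong_AE_imp[OF E(1) qmeas AEeq])
  have "expectation (\<lambda>\<omega>. qnorm2 Q ((X p \<omega> - mat 1) *v (R *v W \<omega>)))
      = expectation (\<lambda>\<omega>. W \<omega> \<bullet> (\<phi> (X p \<omega>) *v W \<omega>))"
    using AEeq by (intro integral_cong_AE qmeas borel_measurable_integrable[OF E(1)]) auto
  also have "\<dots> = expectation (\<lambda>\<omega>. W \<omega> \<bullet> (\<Lambda> *v W \<omega>))"
    by (rule E(2))
  also have "\<dots> \<le> expectation (\<lambda>\<omega>. lambda_max \<Lambda> * (W \<omega> \<bullet> W \<omega>))"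
    using psd\<Lambda> by (intro integral_mono integrable_inner_matrix_const WW integrable_mult_right W
        quadratic_form_le_lambda_max) (auto simp: psd_def)
  finally show "expectation (\<lambda>\<omega>. qnorm2 Q ((X p \<omega> - mat 1) *v (R *v W \<omega>)))
       \<le> lambda_max (expectation (\<lambda>\<omega>. \<phi> (X p \<omega>))) * expectation (\<lambda>\<omega>. W \<omega> \<bullet> W \<omega>)"
    by (simp add: \<Lambda>_def)
qed

section \<open>Convergence of the iteration\<close>

theorem theorem3:
  fixes n :: nat
    and f :: "nat \<Rightarrow> real^'d \<Rightarrow> real"
    and finf_i :: "nat \<Rightarrow> real"
    and finf :: real
    and Li :: "nat \<Rightarrow> real^'d^'d"
    and L D :: "real^'d^'d"
    and M :: "'w measure"
    and Sd :: "(real^'d^'d) measure"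
    and S :: "nat \<Rightarrow> nat \<Rightarrow> 'w \<Rightarrow> real^'d^'d"
    and x :: "nat \<Rightarrow> 'w \<Rightarrow> real^'d"
    and x0 :: "real^'d"
    and K :: nat
  defines "F \<equiv> (\<lambda>y. (1 / real n) * (\<Sum>i<n. f i y))"
  assumes n_pos: "n \<ge> 1"
    and fi_diff: "\<And>i y. i < n \<Longrightarrow> f i differentiable (at y)"
    and fi_lb: "\<And>i y. i < n \<Longrightarrow> finf_i i \<le> f i y"
    and Li_pd: "\<And>i. i < n \<Longrightarrow> pd (Li i)"
    and fi_smooth: "\<And>i. i < n \<Longrightarrow> matrix_smooth (Li i) (f i)"
    and F_lb: "\<And>y. finf \<le> F y"
    and L_psd: "psd L"
    and F_smooth: "matrix_smooth L F"
    and M_prob: "prob_space M"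
    and S_meas: "\<And>i k. S i k \<in> borel_measurable M"
    and S_indep: "prob_space.indep_vars M (\<lambda>_. borel) (\<lambda>(i, k). S i k) ({..<n} \<times> UNIV)"
    and S_distr: "\<And>i k. i < n \<Longrightarrow> distr M borel (S i k) = Sd"
    and Sd_psd: "AE s in Sd. psd s"
    and Sd_int: "integrable Sd (\<lambda>s. s)"
    and Sd_mean: "integral\<^sup>L Sd (\<lambda>s. s) = mat 1"
    and Lam_int: "\<And>i. i < n \<Longrightarrow> integrable Sd (\<lambda>s.
        msqrt (Li i) ** (s - mat 1) ** D ** L ** D ** (s - mat 1) ** msqrt (Li i))"
    and D_pd: "pd D"
    and DLD: "loewner_le (D ** L ** D) D"
    and x_init: "\<And>\<omega>. x 0 \<omega> = x0"
    and x_step: "\<And>k \<omega>. x (Suc k) \<omega> =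
        x k \<omega> - (1 / real n) *\<^sub>R (D *v (\<Sum>i<n. S i k \<omega> *v grad (f i) (x k \<omega>)))"
    and fx_int: "\<And>i k. i < n \<Longrightarrow> integrable M (\<lambda>\<omega>. f i (x k \<omega>))"
    and gx_int: "\<And>k. integrable M (\<lambda>\<omega>.
        qnorm2 ((1 / det D powr (1 / real CARD('d))) *\<^sub>R D) (grad F (x k \<omega>)))"
    and K_pos: "K \<ge> 1"
  shows "let c = det D powr (1 / real CARD('d));
             lamD = Max ((\<lambda>i. lambda_max (integral\<^sup>L Sd (\<lambda>s.
                 msqrt (Li i) ** (s - mat 1) ** D ** L ** D ** (s - mat 1) ** msqrt (Li i)))) ` {..<n});
             Dinf = finf - (1 / real n) * (\<Sum>i<n. finf_i i)
         in Min ((\<lambda>k. integral\<^sup>L M (\<lambda>\<omega>. qnorm2 ((1 / c) *\<^sub>R D) (grad F (x k \<omega>)))) ` {..<K})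
            \<le> 2 * (1 + lamD / real n) ^ K * (F x0 - finf) / (c * real K)
              + 2 * lamD * Dinf / (c * real n)"
proof -
  interpret prob_space M by (rule M_prob)
  define R where "R i = msqrt (Li i)" for i
  define Q where "Q = D ** L ** D"
  define \<phi> where "\<phi> i s = R i ** (s - mat 1) ** Q ** (s - mat 1) ** R i" for i s
  define X where "X = (\<lambda>(i, k). S i k)"
  define I where "I = {..<n} \<times> (UNIV :: nat set)"
  define G where "G = (\<lambda>(i, k) \<omega>. grad (f i) (x k \<omega>))"
  define g where "g k \<omega> = grad F (x k \<omega>)" for k \<omega>
  define \<xi> where "\<xi> k \<omega> = (\<Sum>i<n. (S i k \<omega> - mat 1) *v G (i, k) \<omega>)" for k \<omega>
  define lamD where "lamD = Max ((\<lambda>i. lambda_max (integral\<^sup>L Sd (\<phi> i))) ` {..<n})"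
  define Dinf where "Dinf = finf - (1 / real n) * (\<Sum>i<n. finf_i i)"
  define c where "c = det D powr (1 / real CARD('d))"
  have n: "real n > 0" using n_pos by simp
  have D_sym: "transpose D = D" using D_pd by (simp add: pd_def)
  have Q_psd: "psd Q"
    unfolding Q_def using psd_congruence[OF L_psd, of D] by (simp add: D_sym)
  then have Q_sym: "transpose Q = Q" by (simp add: psd_def)
  \<comment> \<open>A nonzero determinant suffices, because \<open>powr\<close> is positive at every
    nonzero base.\<close>
  have c: "c > 0"
    using pd_invertible[OF D_pd] by (simp add: c_def invertible_det_nz)
  have ind: "indep_vars (\<lambda>_. borel) X I"
    using S_indep by (simp add: X_def I_def)
  have X_simp: "X (i, k) = S i k" for i k by (simp add: X_def)
  have pI: "(i, k) \<in> I" if "i < n" for i k using that by (simp add: I_def)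

  \<comment> \<open>Moments and symmetry of the individual random matrices\<close>
  have sets_Sd: "sets Sd = sets borel"
    using S_distr[of 0 0] n_pos by (metis less_le_trans less_one sets_distr)
  have R_sym: "transpose (R i) = R i" if "i < n" for i
    using msqrt_psd[OF Li_pd[OF that]] by (simp add: R_def psd_def)
  have \<phi>_eq: "\<phi> i = (\<lambda>s. msqrt (Li i) ** (s - mat 1) ** D ** L ** D ** (s - mat 1) ** msqrt (Li i))" for i
    by (simp add: \<phi>_def R_def Q_def matrix_mul_assoc fun_eq_iff)
  have \<phi>_Sd: "integrable Sd (\<phi> i)" if "i < n" for i
    using Lam_int[OF that] by (simp add: \<phi>_eq)
  have transfer: "integrable M (\<lambda>\<omega>. h (S i k \<omega>))" "expectation (\<lambda>\<omega>. h (S i k \<omega>)) = integral\<^sup>L Sd h"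
    if "i < n" "integrable Sd h" for i k and h :: "real^'d^'d \<Rightarrow> real^'d^'d"
  proof -
    have h: "h \<in> borel_measurable borel"
      using borel_measurable_integrable[OF that(2)] measurable_cong_sets[OF sets_Sd refl] by blast
    show "integrable M (\<lambda>\<omega>. h (S i k \<omega>))"
      using that(2) integrable_distr_eq[OF S_meas h, of i k] by (simp only: S_distr[OF that(1)])
    show "expectation (\<lambda>\<omega>. h (S i k \<omega>)) = integral\<^sup>L Sd h"
      using integral_distr[OF S_meas h, of i k] by (simp only: S_distr[OF that(1)])
  qed
  have S_int: "integrable M (S i k)" "expectation (S i k) = mat 1" if "i < n" for i k
    using transfer[OF that Sd_int, of k] Sd_mean by simp_all
  note \<phi>_M = transfer[OF _ \<phi>_Sd]
  have S_sym: "AE \<omega> in M. transpose (S i k \<omega>) = S i k \<omega>" if "i < n" for i k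
  proof -
    have "AE \<omega> in M. psd (S i k \<omega>)"
      using Sd_psd unfolding S_distr[OF that, of k, symmetric] by (rule AE_distrD[OF S_meas])
    then show ?thesis by eventually_elim (simp add: psd_def)
  qed

  \<comment> \<open>Measurability of iterates and gradients\<close>
  have grad_meas: "grad (f i) \<in> borel_measurable borel" if "i < n" for i
    using fi_diff[OF that] by (rule borel_measurable_grad)
  \<comment> \<open>The iterate \<open>x k\<close> involves only matrices with time index below
    \<open>k\<close>, so it avoids \<open>S i l\<close> for every \<open>l \<ge> k\<close>. The
    boundary case \<open>l = k\<close> makes the gradients at \<open>x k\<close> independent of the
    matrix that multiplies them.\<close>
  have x_meas: "x k \<in> borel_measurable (other_vars M X I (i, l))" if "k \<le> l" "i < n" for i k l
    using that
  proof (induction k)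
    case 0
    have "x 0 = (\<lambda>_. x0)" using x_init by blast
    then show ?case by simp
  next
    case (Suc k)
    have xk: "x k \<in> borel_measurable (other_vars M X I (i, l))"
      using Suc by simp
    have "S j k \<in> borel_measurable (other_vars M X I (i, l))" if "j < n" for j
      using measurable_other_vars[OF pI[OF that, of k], of "(i, l)" X M] Suc.prems by (simp add: X_simp)
    then have "(\<lambda>\<omega>. S j k \<omega> *v grad (f j) (x k \<omega>)) \<in> borel_measurable (other_vars M X I (i, l))" if "j < n" for j
      using that measurable_compose[OF xk grad_meas[OF that]]
      by (intro borel_measurable_matrix_vector_mult) auto
    moreover have "x (Suc k) = (\<lambda>\<omega>. x k \<omega> - (1 / real n) *\<^sub>R (D *v (\<Sum>i<n. S i k \<omega> *v grad (f i) (x k \<omega>))))"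
      using x_step by blast
    ultimately show ?case
      using xk by (auto intro!: borel_measurable_diff borel_measurable_scaleR borel_measurable_matrix_vector_mult_const
          borel_measurable_sum)
  qed
  have G_meas: "G (j, k) \<in> borel_measurable (other_vars M X I (i, k))" if "i < n" "j < n" for i j k
    using measurable_compose[OF x_meas[of k k i] grad_meas[OF that(2)]] that by (simp add: G_def)
  have G_M: "G (i, k) \<in> borel_measurable M" if "i < n" for i k
    by (rule borel_measurable_other_vars_imp[OF ind G_meas[OF that that]])

  \<comment> \<open>Square integrability of the gradients\<close>
  have "\<exists>R'. R i ** R' = mat 1" if "i < n" for i
    using msqrt_invertible[OF Li_pd[OF that]] by (auto simp: R_def invertible_def)
  then obtain R' where R': "\<And>i. i < n \<Longrightarrow> R i ** R' i = mat 1"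
    by metis
  \<comment> \<open>This is the gradient of \<open>f i\<close> multiplied by the inverse square root
    of \<open>Li i\<close>, the vector whose squared norm \<open>matrix_smooth_grad_bound\<close>
    controls.\<close>
  define W where "W i k \<omega> = R' i *v G (i, k) \<omega>" for i k \<omega>
  have RW: "R i *v W i k \<omega> = G (i, k) \<omega>" if "i < n" for i k \<omega>
    by (simp add: W_def matrix_vector_mul_assoc R'[OF that])
  have W_meas: "W i k \<in> borel_measurable (other_vars M X I (i, k))" if "i < n" for i k
    unfolding W_def by (intro borel_measurable_matrix_vector_mult_const G_meas that)
  have W_le: "W i k \<omega> \<bullet> W i k \<omega> \<le> 2 * (f i (x k \<omega>) - finf_i i)" if "i < n" for i k \<omega>
    using RW[OF that, of k \<omega>]
    by (intro matrix_smooth_grad_bound[OF Li_pd[OF that] fi_smooth[OF that] fi_lb[OF that]]) (simp add: R_def G_def)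
  \<comment> \<open>Integrable function values thus dominate the squares of \<open>W\<close>, and
    applying \<open>R i\<close> carries square integrability over to the gradients.\<close>
  have f_int: "integrable M (\<lambda>\<omega>. 2 * (f i (x k \<omega>) - finf_i i))" if "i < n" for i k
    using fx_int[OF that] by simp
  have W_int: "integrable M (\<lambda>\<omega>. W i k \<omega> \<bullet> W i k \<omega>)" if "i < n" for i k
  proof (rule Bochner_Integration.integrable_bound[OF f_int[OF that, of k]])
    have "W i k \<in> borel_measurable M"
      by (rule borel_measurable_other_vars_imp[OF ind W_meas[OF that]])
    then show "(\<lambda>\<omega>. W i k \<omega> \<bullet> W i k \<omega>) \<in> borel_measurable M"
      by (intro borel_measurable_inner)
    show "AE \<omega> in M. norm (W i k \<omega> \<bullet> W i k \<omega>) \<le> norm (2 * (f i (x k \<omega>) - finf_i i))"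
      using W_le[OF that, of k] by (intro AE_I2) (smt (verit) inner_ge_zero real_norm_def)
  qed
  have G_int: "integrable M (\<lambda>\<omega>. G (i, k) \<omega> \<bullet> G (i, k) \<omega>)" if "i < n" for i k
    using square_integrable_matrix_mult[OF borel_measurable_other_vars_imp[OF ind W_meas[OF that]] W_int[OF that],
        of "R i" k] by (simp add: RW[OF that])

  \<comment> \<open>Variance of one noise term\<close>
  have lam_le: "lambda_max (integral\<^sup>L Sd (\<phi> i)) \<le> lamD" if "i < n" for i
    unfolding lamD_def using that by (intro Max_ge) auto
  have var: "integrable M (\<lambda>\<omega>. qnorm2 Q ((S i k \<omega> - mat 1) *v G (i, k) \<omega>))"
      "expectation (\<lambda>\<omega>. qnorm2 Q ((S i k \<omega> - mat 1) *v G (i, k) \<omega>))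
        \<le> lambda_max (integral\<^sup>L Sd (\<phi> i)) * expectation (\<lambda>\<omega>. W i k \<omega> \<bullet> W i k \<omega>)"
      "0 \<le> lambda_max (integral\<^sup>L Sd (\<phi> i))" if i: "i < n" for i k
    using expectation_qnorm2_centered_le[OF ind pI[OF i, of k] R_sym[OF i] Q_psd, where W = "W i k"]
      S_sym[OF i, of k] \<phi>_M[OF i i, of k] W_meas[OF i, of k] W_int[OF i, of k]
    by (simp_all add: X_simp RW[OF i] flip: \<phi>_def)
  \<comment> \<open>Index 0 exists because \<open>n \<ge> 1\<close>, so the maximum dominates at
    least one nonnegative eigenvalue.\<close>
  have lamD: "0 \<le> lamD"
    using var(3)[of 0] lam_le[of 0] n_pos by simp
  have var_le: "expectation (\<lambda>\<omega>. qnorm2 Q ((S i k \<omega> - mat 1) *v G (i, k) \<omega>))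
      \<le> 2 * lamD * (expectation (\<lambda>\<omega>. f i (x k \<omega>)) - finf_i i)" if i: "i < n" for i k
  proof -
    have "expectation (\<lambda>\<omega>. W i k \<omega> \<bullet> W i k \<omega>) \<le> expectation (\<lambda>\<omega>. 2 * (f i (x k \<omega>) - finf_i i))"
      by (intro integral_mono W_int f_int W_le i)
    also have "\<dots> = 2 * (expectation (\<lambda>\<omega>. f i (x k \<omega>)) - finf_i i)"
      using fx_int[OF i] by (simp add: prob_space)
    finally have "lambda_max (integral\<^sup>L Sd (\<phi> i)) * expectation (\<lambda>\<omega>. W i k \<omega> \<bullet> W i k \<omega>)
        \<le> lamD * (2 * (expectation (\<lambda>\<omega>. f i (x k \<omega>)) - finf_i i))"
      using lam_le[OF i] lamD by (intro mult_mono) auto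
    also have "\<dots> = 2 * lamD * (expectation (\<lambda>\<omega>. f i (x k \<omega>)) - finf_i i)"
      by (simp only: mult.assoc mult.left_commute)
    finally show ?thesis
      using var(2)[OF i, of k] by linarith
  qed

  \<comment> \<open>Averaged gradient and total noise of one step\<close>
  have g_eq: "g k \<omega> = (1 / real n) *\<^sub>R (\<Sum>i<n. G (i, k) \<omega>)" for k \<omega>
    unfolding g_def F_def G_def using grad_average[of "{..<n}" f "x k \<omega>" "1 / real n"] fi_diff by simp
  have g_meas: "g k \<in> borel_measurable (other_vars M X I (i, k))" if "i < n" for i k
    unfolding g_eq using G_meas[OF that] by (intro borel_measurable_scaleR borel_measurable_sum) auto
  have g_M: "g k \<in> borel_measurable M" for k
    using borel_measurable_other_vars_imp[OF ind g_meas[of 0]] n_pos by simp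
  have g_int: "integrable M (\<lambda>\<omega>. g k \<omega> \<bullet> g k \<omega>)" for k
    unfolding g_eq using square_integrable_sum[of "{..<n}" "\<lambda>i. G (i, k)" M] G_M G_int by simp
  \<comment> \<open>The coefficient of the noise in the linear term of
    \<open>matrix_smooth_preconditioned_descent\<close>.\<close>
  define u where "u k \<omega> = (Q - D) *v g k \<omega>" for k \<omega>

  \<comment> \<open>The index pairs of step \<open>k\<close>, a finite part of the independent
    family to which the lemmas on centered sums are applied.\<close>
  define P where "P k = (\<lambda>i. (i, k)) ` {..<n}" for k :: nat
  have P: "P k \<subseteq> I" "finite (P k)" for k by (auto simp: P_def I_def)
  have sum_P: "(\<Sum>p\<in>P k. h p) = (\<Sum>i<n. h (i, k))" for h :: "nat \<times> nat \<Rightarrow> 'z::comm_monoid_add" and k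
    unfolding P_def by (subst sum.reindex) (auto simp: inj_on_def)
  have \<xi>_eq: "\<xi> k \<omega> = (\<Sum>p\<in>P k. (X p \<omega> - mat 1) *v G p \<omega>)" for k \<omega>
    unfolding \<xi>_def sum_P X_simp ..
  have X_P: "integrable M (X p)" "expectation (X p) = mat 1" if "p \<in> P k" for p k
    using that S_int by (auto simp: P_def X_simp)
  have G_P: "G q \<in> borel_measurable (other_vars M X I p)" if "p \<in> P k" "q \<in> P k" for p q k
    using that G_meas by (auto simp: P_def)
  have G_P2: "integrable M (\<lambda>\<omega>. G p \<omega> \<bullet> G p \<omega>)" if "p \<in> P k" for p k
    using that G_int by (auto simp: P_def)
  have cross: "integrable M (\<lambda>\<omega>. u k \<omega> \<bullet> \<xi> k \<omega>)" "expectation (\<lambda>\<omega>. u k \<omega> \<bullet> \<xi> k \<omega>) = 0" for k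
  proof -
    have u1: "u k \<in> borel_measurable (other_vars M X I p)" if "p \<in> P k" for p
      using that g_meas unfolding u_def by (intro borel_measurable_matrix_vector_mult_const) (auto simp: P_def)
    have u2: "integrable M (\<lambda>\<omega>. u k \<omega> \<bullet> u k \<omega>)"
      unfolding u_def by (intro square_integrable_matrix_mult g_M g_int)
    note * = expectation_inner_centered_sum_eq_0[where P = "P k" and G = G, OF ind P(1) X_P u1 u2 G_P G_P2]
    show "integrable M (\<lambda>\<omega>. u k \<omega> \<bullet> \<xi> k \<omega>)" "expectation (\<lambda>\<omega>. u k \<omega> \<bullet> \<xi> k \<omega>) = 0"
      unfolding \<xi>_eq by (rule *; assumption)+
  qed
  have noise: "integrable M (\<lambda>\<omega>. qnorm2 Q (\<xi> k \<omega>))"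
      "expectation (\<lambda>\<omega>. qnorm2 Q (\<xi> k \<omega>)) = (\<Sum>i<n. expectation (\<lambda>\<omega>. qnorm2 Q ((S i k \<omega> - mat 1) *v G (i, k) \<omega>)))" for k
  proof -
    have v: "integrable M (\<lambda>\<omega>. qnorm2 Q ((X p \<omega> - mat 1) *v G p \<omega>))" if "p \<in> P k" for p
      using that var(1) by (auto simp: P_def X_simp)
    note * = expectation_qnorm2_centered_sum[where P = "P k" and G = G, OF ind P X_P G_P G_P2 Q_sym v]
    show "integrable M (\<lambda>\<omega>. qnorm2 Q (\<xi> k \<omega>))"
      unfolding \<xi>_eq by (rule *(1); assumption)
    have "expectation (\<lambda>\<omega>. qnorm2 Q (\<xi> k \<omega>)) = (\<Sum>p\<in>P k. expectation (\<lambda>\<omega>. qnorm2 Q ((X p \<omega> - mat 1) *v G p \<omega>)))"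
      unfolding \<xi>_eq by (rule *(2); assumption)
    then show "expectation (\<lambda>\<omega>. qnorm2 Q (\<xi> k \<omega>)) = (\<Sum>i<n. expectation (\<lambda>\<omega>. qnorm2 Q ((S i k \<omega> - mat 1) *v G (i, k) \<omega>)))"
      by (simp add: sum_P X_simp)
  qed

  \<comment> \<open>One-step inequality in expectation\<close>
  have F_int: "integrable M (\<lambda>\<omega>. F (x k \<omega>))" for k
    unfolding F_def using fx_int by (intro integrable_mult_right Bochner_Integration.integrable_sum) auto
  have EF: "expectation (\<lambda>\<omega>. F (x k \<omega>)) = (1 / real n) * (\<Sum>i<n. expectation (\<lambda>\<omega>. f i (x k \<omega>)))" for k
    unfolding F_def using fx_int by (simp add: Bochner_Integration.integral_sum)
  have qD_int: "integrable M (\<lambda>\<omega>. qnorm2 D (g k \<omega>))" for k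
    unfolding qnorm2_def by (intro integrable_inner_matrix_const integrable_mult_square_integrable g_M g_int)
  have descent: "F (x (Suc k) \<omega>) \<le> F (x k \<omega>) - qnorm2 D (g k \<omega>) / 2 + (u k \<omega> \<bullet> \<xi> k \<omega>) / real n
      + qnorm2 Q (\<xi> k \<omega>) / (2 * (real n)\<^sup>2)" for k \<omega>
  proof -
    \<comment> \<open>Splitting each \<open>S i k\<close> into identity plus centered part writes
      the step as a preconditioned gradient step with perturbation
      \<open>\<xi> k / n\<close>.\<close>
    have "(\<Sum>i<n. S i k \<omega> *v grad (f i) (x k \<omega>)) = (\<Sum>i<n. G (i, k) \<omega>) + \<xi> k \<omega>"
      by (simp add: \<xi>_def G_def sum.distrib[symmetric] matrix_vector_mult_diff_rdistrib)
    then have "x (Suc k) \<omega> = x k \<omega> - D *v (g k \<omega> + (1 / real n) *\<^sub>R \<xi> k \<omega>)"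
      unfolding x_step g_eq by (simp add: matrix_vector_right_distrib matrix_vector_mult_scaleR scaleR_add_right)
    then show ?thesis
      using matrix_smooth_preconditioned_descent[OF F_smooth L_psd D_sym DLD, of "x k \<omega>" "(1 / real n) *\<^sub>R \<xi> k \<omega>"]
      by (simp add: g_def u_def Q_def qnorm2_def matrix_vector_mult_scaleR matrix_vector_mult_diff_rdistrib
          power2_eq_square)
  qed
  have step: "expectation (\<lambda>\<omega>. F (x (Suc k) \<omega>)) - finf \<le> (1 + lamD / real n) * (expectation (\<lambda>\<omega>. F (x k \<omega>)) - finf)
      - expectation (\<lambda>\<omega>. qnorm2 D (g k \<omega>)) / 2 + lamD * Dinf / real n" for k
  proof -
    let ?V = "\<Sum>i<n. expectation (\<lambda>\<omega>. qnorm2 Q ((S i k \<omega> - mat 1) *v G (i, k) \<omega>))"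
    have "?V \<le> (\<Sum>i<n. 2 * lamD * (expectation (\<lambda>\<omega>. f i (x k \<omega>)) - finf_i i))"
      using var_le by (intro sum_mono) auto
    also have "\<dots> = 2 * lamD * ((\<Sum>i<n. expectation (\<lambda>\<omega>. f i (x k \<omega>))) - (\<Sum>i<n. finf_i i))"
      by (simp only: sum_distrib_left[symmetric] sum_subtractf)
    \<comment> \<open>Adding and subtracting \<open>finf\<close> separates the suboptimality of
      \<open>F\<close> from the constant \<open>Dinf\<close>. The factor \<open>2 * real n\<close>
      then cancels against \<open>2 * (real n)\<^sup>2\<close>, leaving the rate
      \<open>lamD / n\<close>.\<close>
    also have "\<dots> = 2 * lamD * real n * ((expectation (\<lambda>\<omega>. F (x k \<omega>)) - finf) + Dinf)"
      using n by (simp add: EF Dinf_def field_simps)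
    finally have "?V / (2 * (real n)\<^sup>2)
        \<le> 2 * lamD * real n * ((expectation (\<lambda>\<omega>. F (x k \<omega>)) - finf) + Dinf) / (2 * (real n)\<^sup>2)"
      by (intro divide_right_mono) auto
    also have "\<dots> = lamD / real n * (expectation (\<lambda>\<omega>. F (x k \<omega>)) - finf) + lamD * Dinf / real n"
      using n by (simp add: power2_eq_square field_simps)
    finally have V: "?V / (2 * (real n)\<^sup>2)
        \<le> lamD / real n * (expectation (\<lambda>\<omega>. F (x k \<omega>)) - finf) + lamD * Dinf / real n" .
    have "expectation (\<lambda>\<omega>. F (x (Suc k) \<omega>)) \<le> expectation (\<lambda>\<omega>. F (x k \<omega>) - qnorm2 D (g k \<omega>) / 2
        + (u k \<omega> \<bullet> \<xi> k \<omega>) / real n + qnorm2 Q (\<xi> k \<omega>) / (2 * (real n)\<^sup>2))"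
      by (intro integral_mono descent F_int Bochner_Integration.integrable_add Bochner_Integration.integrable_diff
          integrable_divide qD_int cross noise)
    also have "\<dots> = expectation (\<lambda>\<omega>. F (x k \<omega>)) - expectation (\<lambda>\<omega>. qnorm2 D (g k \<omega>)) / 2 + ?V / (2 * (real n)\<^sup>2)"
      using F_int[of k] qD_int[of k] cross[of k] noise[of k] by simp
    finally show ?thesis
      using V by (simp add: distrib_right)
  qed

  \<comment> \<open>Normalization by the determinant and summation over the steps\<close>
  have qc: "qnorm2 ((1 / c) *\<^sub>R D) y = qnorm2 D y / c" for y
    by (simp add: qnorm2_def scaleR_matrix_vector_assoc[symmetric])
  have "Min ((\<lambda>k. expectation (\<lambda>\<omega>. qnorm2 ((1 / c) *\<^sub>R D) (g k \<omega>))) ` {..<K})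
      \<le> 2 * (1 + lamD / real n) ^ K * ((expectation (\<lambda>\<omega>. F (x 0 \<omega>)) - finf) / c) / real K
        + 2 * (lamD * Dinf / real n / c)"
  \<comment> \<open>The one-step inequality is divided by \<open>c\<close>, so the recursion runs
    with \<open>a = lamD / n\<close> and \<open>b = lamD * Dinf / (n * c)\<close>, and its
    \<open>r k\<close> is already the normalized gradient norm.\<close>
  proof (rule weighted_descent_min_le[where \<delta> = "\<lambda>k. (expectation (\<lambda>\<omega>. F (x k \<omega>)) - finf) / c"])
    show "(expectation (\<lambda>\<omega>. F (x (Suc k) \<omega>)) - finf) / c
        \<le> (1 + lamD / real n) * ((expectation (\<lambda>\<omega>. F (x k \<omega>)) - finf) / c)
          - expectation (\<lambda>\<omega>. qnorm2 ((1 / c) *\<^sub>R D) (g k \<omega>)) / 2 + lamD * Dinf / real n / c" for k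
      using divide_right_mono[OF step[of k] less_imp_le[OF c]]
      by (simp add: qc add_divide_distrib diff_divide_distrib right_diff_distrib mult.commute)
    show "0 \<le> (expectation (\<lambda>\<omega>. F (x k \<omega>)) - finf) / c" for k
    proof -
      have "expectation (\<lambda>\<omega>. finf) \<le> expectation (\<lambda>\<omega>. F (x k \<omega>))"
        by (intro integral_mono F_int F_lb) simp
      then show ?thesis using c by (simp add: prob_space)
    qed
  qed (use lamD n K_pos in auto)
  also have "expectation (\<lambda>\<omega>. F (x 0 \<omega>)) = F x0"
    by (simp add: x_init prob_space)
  finally have "Min ((\<lambda>k. expectation (\<lambda>\<omega>. qnorm2 ((1 / c) *\<^sub>R D) (g k \<omega>))) ` {..<K})
      \<le> 2 * (1 + lamD / real n) ^ K * (F x0 - finf) / (c * real K) + 2 * lamD * Dinf / (c * real n)"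
    by (simp add: mult.commute)
  then show ?thesis
    unfolding Let_def c_def[symmetric] \<phi>_eq[symmetric] lamD_def[symmetric] Dinf_def[symmetric] g_def[symmetric] .
qed

end
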